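(* Let $F$ be a field, let $A$ be a finite-dimensional algebra over $F$, and let $H$ be an additive subgroup of $A$ that spans $A$ as an $F$-vector space. Then $H$ contains a unit of $A$.
   Context: An algebra over a commutative ring $F$ is a ring $A$ (associative with $1$, not necessarily commutative) equipped with a ring homomorphism from $F$ to the center of $A$. When $F$ is a field, the algebra $A$ is called finite-dimensional if its dimension as an $F$-vector space is finite. An additive subgroup of $A$ is a subgroup of the additive group of $A$; it is not required to be an $F$-subspace. *)

theory Defs
  imports Complex_Main
begin

text \<open>
  The sort \<open>{ring, monoid_mult}\<close> is that of associative rings with \<open>1\<close>. Unlike
  \<open>ring_1\<close> it does not demand \<open>0 \<noteq> 1\<close>, so the zero ring is included.
\<close>

locale algebra_over =
  fixes \<phi> :: "'f::comm_ring_1 \<Rightarrow> 'a::{ring,monoid_mult}"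
  assumes hom_add: "\<phi> (c + d) = \<phi> c + \<phi> d"
    and hom_mult: "\<phi> (c * d) = \<phi> c * \<phi> d"
    and hom_one: "\<phi> 1 = 1"
    and central: "\<phi> c * x = x * \<phi> c"

definition algebra_scale :: "('f \<Rightarrow> 'a::times) \<Rightarrow> 'f \<Rightarrow> 'a \<Rightarrow> 'a" where
  "algebra_scale \<phi> c x = \<phi> c * x"

sublocale algebra_over \<subseteq> module "algebra_scale \<phi>"
  by unfold_locales
    (simp_all add: algebra_scale_def hom_add hom_mult hom_one algebra_simps)

lemma algebra_over_field_vector_space:
  fixes \<phi> :: "'f::field \<Rightarrow> 'a::{ring,monoid_mult}"
  assumes "algebra_over \<phi>"
  shows "vector_space (algebra_scale \<phi>)"
proof -
  interpret algebra_over \<phi> by (rule assms)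
  show ?thesis
    by unfold_locales
      (simp_all add: algebra_scale_def hom_add hom_mult hom_one algebra_simps)
qed

definition finite_dimensional_algebra ::
    "('f::field \<Rightarrow> 'a::{ring,monoid_mult}) \<Rightarrow> bool" where
  "finite_dimensional_algebra \<phi> \<longleftrightarrow>
     algebra_over \<phi> \<and> (\<exists>B. finite_dimensional_vector_space (algebra_scale \<phi>) B)"

definition add_subgroup :: "'a::group_add set \<Rightarrow> bool" where
  "add_subgroup H \<longleftrightarrow>
     0 \<in> H \<and> (\<forall>x\<in>H. \<forall>y\<in>H. x + y \<in> H) \<and> (\<forall>x\<in>H. - x \<in> H)"

definition ring_unit :: "'a::monoid_mult \<Rightarrow> bool" where
  "ring_unit u \<longleftrightarrow> (\<exists>v. u * v = 1 \<and> v * u = 1)"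

end

theory Submission
  imports Defs "HOL-Library.Function_Algebras" "HOL-Algebra.Algebraic_Closure_Type"
    "Jordan_Normal_Form.Determinant"
begin

text \<open>
  Let \<open>K\<close> be an algebraic closure of \<open>F\<close> and let \<open>A\<close> act on the scalar extension to \<open>K\<close> of its
  dual. Among the composition factors \<open>V/W\<close> of this module choose an irredundant family such that
  an element acting injectively on all of its members acts injectively on the whole module.
  Irredundancy makes the image of \<open>K \<otimes> A\<close> in the endomorphisms of the direct sum of the family
  contain every diagonal matrix unit: an element singular on exactly one member yields, through its
  annihilating polynomial, an element vanishing on exactly the others, and Jacobson density
  (with an eigenvector argument in place of Schur's lemma) does the rest.

  If no element of \<open>H\<close> were a unit, the determinant of this block diagonal representation would
  vanish on \<open>H\<close>. As \<open>H\<close> is closed under addition, so would the full polarization of the determinant.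
  The latter is multilinear, so it would vanish on the \<open>K\<close>-span of \<open>H\<close>; but at the diagonal matrix
  units it is \<open>1\<close>. Polarizing a determinant without repeated factors is what makes the argument
  independent of the characteristic and of the size of \<open>F\<close>.
\<close>

section \<open>The mixed discriminant\<close>

lemma sum_alternating_supersets:
  assumes "finite I" "A \<subset> I"
  shows "(\<Sum>S | A \<subseteq> S \<and> S \<subseteq> I. (- 1) ^ card S) = (0 :: 'a::comm_ring_1)"
proof (rule sum_alternating_cancels)
  show "finite {S. A \<subseteq> S \<and> S \<subseteq> I}"
    using assms(1) by (auto intro: finite_subset[of _ "Pow I"])
  show "card {S \<in> {S. A \<subseteq> S \<and> S \<subseteq> I}. even (card S)} = card {S \<in> {S. A \<subseteq> S \<and> S \<subseteq> I}. odd (card S)}"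
    using card_subsupersets_even_odd[OF assms] by (simp add: conj_commute conj_left_commute)
qed

text \<open>The sum over \<open>g\<close> on the right is the permanent of \<open>a\<close>, since
  the surjective maps of the finite set \<open>I\<close> to itself are its permutations. Expanding
  each product over all maps \<open>g\<close>, a set \<open>S\<close> contributes exactly when it
  contains the image of \<open>g\<close>; the alternating sum over such \<open>S\<close> cancels
  unless the image is all of \<open>I\<close>.\<close>

lemma ryser_formula:
  fixes a :: "'i \<Rightarrow> 'i \<Rightarrow> 'a::comm_ring_1"
  assumes I: "finite I"
  shows "(\<Sum>S\<in>Pow I. (- 1) ^ card S * (\<Prod>r\<in>I. \<Sum>i\<in>S. a i r)) =
    (- 1) ^ card I * (\<Sum>g | g \<in> I \<rightarrow>\<^sub>E I \<and> g ` I = I. \<Prod>r\<in>I. a (g r) r)"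
proof -
  have prod: "(\<Prod>r\<in>I. \<Sum>i\<in>S. a i r) = (\<Sum>g\<in>I \<rightarrow>\<^sub>E I. if g ` I \<subseteq> S then \<Prod>r\<in>I. a (g r) r else 0)"
    if "S \<subseteq> I" for S
  proof -
    have "(\<Prod>r\<in>I. \<Sum>i\<in>S. a i r) = (\<Sum>g\<in>I \<rightarrow>\<^sub>E S. \<Prod>r\<in>I. a (g r) r)"
      using that I finite_subset by (intro prod_sum_PiE) auto
    also have "I \<rightarrow>\<^sub>E S = {g \<in> I \<rightarrow>\<^sub>E I. g ` I \<subseteq> S}"
      using that by (auto simp: PiE_iff image_subset_iff extensional_def)
    finally show ?thesis
      using I by (simp add: sum.inter_filter finite_PiE)
  qed
  have "(\<Sum>S\<in>Pow I. (- 1) ^ card S * (\<Prod>r\<in>I. \<Sum>i\<in>S. a i r)) =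
    (\<Sum>S\<in>Pow I. \<Sum>g\<in>I \<rightarrow>\<^sub>E I. if g ` I \<subseteq> S then (- 1) ^ card S * (\<Prod>r\<in>I. a (g r) r) else 0)"
    by (intro sum.cong) (auto simp: prod sum_distrib_left intro!: sum.cong)
  also have "\<dots> = (\<Sum>g\<in>I \<rightarrow>\<^sub>E I. \<Sum>S\<in>Pow I. if g ` I \<subseteq> S then (- 1) ^ card S * (\<Prod>r\<in>I. a (g r) r) else 0)"
    by (rule sum.swap)
  also have "\<dots> = (\<Sum>g\<in>I \<rightarrow>\<^sub>E I. if g ` I = I then (- 1) ^ card I * (\<Prod>r\<in>I. a (g r) r) else 0)"
  proof (rule sum.cong)
    fix g assume "g \<in> I \<rightarrow>\<^sub>E I"
    then have sub: "g ` I \<subseteq> I" by auto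
    have "(\<Sum>S\<in>Pow I. if g ` I \<subseteq> S then (- 1) ^ card S * (\<Prod>r\<in>I. a (g r) r) else 0) =
      (\<Sum>S | g ` I \<subseteq> S \<and> S \<subseteq> I. (- 1) ^ card S * (\<Prod>r\<in>I. a (g r) r))"
      using I by (subst sum.inter_filter[symmetric]) (auto intro!: sum.cong)
    also have "\<dots> = (\<Sum>S | g ` I \<subseteq> S \<and> S \<subseteq> I. (- 1) ^ card S) * (\<Prod>r\<in>I. a (g r) r)"
      by (simp add: sum_distrib_right)
    also have "\<dots> = (if g ` I = I then (- 1) ^ card I * (\<Prod>r\<in>I. a (g r) r) else 0)"
    proof (cases "g ` I = I")
      case True
      then have "{S. g ` I \<subseteq> S \<and> S \<subseteq> I} = {I}" by auto
      then show ?thesis using True by simp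
    next
      case False
      then have "g ` I \<subset> I"
        using sub by blast
      then show ?thesis
        using False by (simp add: sum_alternating_supersets[OF I])
    qed
    finally show "(\<Sum>S\<in>Pow I. if g ` I \<subseteq> S then (- 1) ^ card S * (\<Prod>r\<in>I. a (g r) r) else 0) =
      (if g ` I = I then (- 1) ^ card I * (\<Prod>r\<in>I. a (g r) r) else 0)" .
  qed simp
  also have "\<dots> = (\<Sum>g | g \<in> I \<rightarrow>\<^sub>E I \<and> g ` I = I. (- 1) ^ card I * (\<Prod>r\<in>I. a (g r) r))"
    using I by (simp add: sum.inter_filter[symmetric] finite_PiE)
  finally show ?thesis
    by (simp add: sum_distrib_left)
qed

section \<open>Matrices as functions and the polarized determinant\<close>

lemma vector_space_fun:
  "vector_space s \<Longrightarrow> vector_space (\<lambda>c f x. s c (f x))"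
  unfolding vector_space_def by (simp add: fun_eq_iff plus_fun_def)

text \<open>Matrices are plain functions on an arbitrary index type, so that rows and columns can be
  labelled by basis vectors of composition factors. They become a \<open>mat\<close> only where
  \<open>det\<close> is taken, through an enumeration \<open>f\<close> of the relevant
  indices.\<close>

abbreviation mat_scale :: "'k::field \<Rightarrow> ('i \<Rightarrow> 'i \<Rightarrow> 'k) \<Rightarrow> 'i \<Rightarrow> 'i \<Rightarrow> 'k" where
  "mat_scale \<equiv> \<lambda>c N i j. c * N i j"

lemma vector_space_mat_scale: "vector_space mat_scale"
proof -
  have "vector_space ((*) :: 'a \<Rightarrow> 'a \<Rightarrow> 'a)"
    by unfold_locales (simp_all add: algebra_simps)
  then show ?thesis
    by (intro vector_space_fun)
qed

text \<open>The full polarization of the determinant, without the usual factor \<open>1 / n!\<close>.\<close>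

definition mixed_det :: "nat \<Rightarrow> (nat \<Rightarrow> 'i) \<Rightarrow> (nat \<Rightarrow> 'i \<Rightarrow> 'i \<Rightarrow> 'k::field) \<Rightarrow> 'k" where
  "mixed_det n f N = (\<Sum>p | p permutes {0..<n}. signof p *
     (\<Sum>g | g \<in> {0..<n} \<rightarrow>\<^sub>E {0..<n} \<and> g ` {0..<n} = {0..<n}.
       \<Prod>r\<in>{0..<n}. N (g r) (f r) (f (p r))))"

text \<open>Apply Ryser's formula to the product attached to each permutation in the Leibniz
  expansion. The point is that the right-hand side vanishes as soon as \<open>det\<close> vanishes
  on all partial sums of the \<open>N k\<close>. No division by \<open>n!\<close> occurs, so this
  works in every characteristic.\<close>

lemma mixed_det_polarization:
  "(\<Sum>S\<in>Pow {0..<n}. (- 1) ^ card S * det (mat n n (\<lambda>(a, b). \<Sum>k\<in>S. N k (f a) (f b)))) =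
     (- 1) ^ n * mixed_det n f N"
proof -
  have "(\<Sum>S\<in>Pow {0..<n}. (- 1) ^ card S * det (mat n n (\<lambda>(a, b). \<Sum>k\<in>S. N k (f a) (f b)))) =
    (\<Sum>S\<in>Pow {0..<n}. \<Sum>p | p permutes {0..<n}.
      signof p * ((- 1) ^ card S * (\<Prod>r\<in>{0..<n}. \<Sum>k\<in>S. N k (f r) (f (p r)))))"
  proof (rule sum.cong)
    fix S
    have "(\<Prod>r = 0..<n. mat n n (\<lambda>(a, b). \<Sum>k\<in>S. N k (f a) (f b)) $$ (r, p r)) =
      (\<Prod>r = 0..<n. \<Sum>k\<in>S. N k (f r) (f (p r)))" if "p permutes {0..<n}" for p
      using permutes_in_image[OF that] by (intro prod.cong) auto
    then show "(- 1) ^ card S * det (mat n n (\<lambda>(a, b). \<Sum>k\<in>S. N k (f a) (f b))) =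
      (\<Sum>p | p permutes {0..<n}.
        signof p * ((- 1) ^ card S * (\<Prod>r\<in>{0..<n}. \<Sum>k\<in>S. N k (f r) (f (p r)))))"
      by (subst det_def'[of _ n]) (auto simp: sum_distrib_left mult.left_commute intro!: sum.cong)
  qed simp
  also have "\<dots> = (\<Sum>p | p permutes {0..<n}. \<Sum>S\<in>Pow {0..<n}.
      signof p * ((- 1) ^ card S * (\<Prod>r\<in>{0..<n}. \<Sum>k\<in>S. N k (f r) (f (p r)))))"
    by (rule sum.swap)
  also have "\<dots> = (\<Sum>p | p permutes {0..<n}. signof p *
      (\<Sum>S\<in>Pow {0..<n}. (- 1) ^ card S * (\<Prod>r\<in>{0..<n}. \<Sum>k\<in>S. N k (f r) (f (p r)))))"
    by (simp add: sum_distrib_left)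
  also have "\<dots> = (- 1) ^ n * mixed_det n f N"
    by (subst ryser_formula) (simp_all add: mixed_det_def sum_distrib_left mult.left_commute)
  finally show ?thesis .
qed

text \<open>A surjective \<open>g\<close> takes the value \<open>k\<close> exactly once, at
  \<open>r g\<close>. Hence each product contains exactly one entry of the \<open>k\<close>-th
  matrix, and the remaining factors \<open>c p g\<close> do not involve \<open>Y\<close>: this is
  linearity in the \<open>k\<close>-th argument.\<close>

lemma mixed_det_upd:
  assumes k: "k < n"
  obtains c r where
    "\<And>Y. mixed_det n f (N(k := Y)) = (\<Sum>p | p permutes {0..<n}. signof p *
       (\<Sum>g | g \<in> {0..<n} \<rightarrow>\<^sub>E {0..<n} \<and> g ` {0..<n} = {0..<n}.
         Y (f (r g)) (f (p (r g))) * c p g))"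
proof -
  let ?r = "\<lambda>g. inv_into {0..<n} g k"
  have "(\<Prod>q\<in>{0..<n}. (N(k := Y)) (g q) (f q) (f (p q))) =
      Y (f (?r g)) (f (p (?r g))) * (\<Prod>q\<in>{0..<n} - {?r g}. N (g q) (f q) (f (p q)))"
    if g: "g ` {0..<n} = {0..<n}" for Y g p
  proof -
    have inj: "inj_on g {0..<n}"
      using g by (simp add: eq_card_imp_inj_on)
    have kg: "k \<in> g ` {0..<n}"
      using g k by simp
    have r: "?r g \<in> {0..<n}" "g (?r g) = k"
      using inv_into_into[OF kg] f_inv_into_f[OF kg] by auto
    have "g q \<noteq> k" if "q \<in> {0..<n} - {?r g}" for q
      using that r inj_onD[OF inj, of q "?r g"] by (metis DiffE insertI1)
    then have "(\<Prod>q\<in>{0..<n} - {?r g}. (N(k := Y)) (g q) (f q) (f (p q))) =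
        (\<Prod>q\<in>{0..<n} - {?r g}. N (g q) (f q) (f (p q)))"
      by (intro prod.cong) auto
    then show ?thesis
      using r by (subst prod.remove[of _ "?r g"]) auto
  qed
  then show thesis
    by (intro that[of ?r "\<lambda>p g. \<Prod>q\<in>{0..<n} - {?r g}. N (g q) (f q) (f (p q))"])
      (auto simp: mixed_det_def intro!: sum.cong)
qed

text \<open>Linearity in one argument, phrased so that \<open>span_minimal\<close> can pass from a
  set of matrices to its span.\<close>

lemma subspace_mixed_det_zero:
  assumes "k < n"
  shows "module.subspace mat_scale {Y. mixed_det n f (N(k := Y)) = 0}"
proof -
  interpret vector_space mat_scale
    by (rule vector_space_mat_scale)
  obtain c r where eq: "\<And>Y. mixed_det n f (N(k := Y)) = (\<Sum>p | p permutes {0..<n}. signof p *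
       (\<Sum>g | g \<in> {0..<n} \<rightarrow>\<^sub>E {0..<n} \<and> g ` {0..<n} = {0..<n}.
         Y (f (r g)) (f (p (r g))) * c p g))"
    using mixed_det_upd[OF assms, of f N] by blast
  have "mixed_det n f (N(k := Y + Z)) = mixed_det n f (N(k := Y)) + mixed_det n f (N(k := Z))" for Y Z
    by (simp add: eq distrib_right distrib_left sum.distrib)
  moreover have "mixed_det n f (N(k := mat_scale a Y)) = a * mixed_det n f (N(k := Y))" for a Y
    by (simp add: eq sum_distrib_left mult_ac)
  moreover have "mixed_det n f (N(k := 0)) = 0"
    by (simp add: eq)
  ultimately show ?thesis
    by (intro subspaceI) auto
qed

text \<open>The factor at \<open>r\<close> is nonzero only if \<open>r = g r = p r\<close>, so only
  the identity permutation together with the identity choice of matrices survives.\<close>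

lemma mixed_det_units:
  fixes N :: "nat \<Rightarrow> 'i \<Rightarrow> 'i \<Rightarrow> 'k::field"
  assumes N: "\<And>k a b. k < n \<Longrightarrow> a < n \<Longrightarrow> b < n \<Longrightarrow> N k (f a) (f b) = (if a = k \<and> b = k then 1 else 0)"
  shows "mixed_det n f N = 1"
proof -
  have inner: "(\<Prod>r\<in>{0..<n}. N (g r) (f r) (f (p r))) =
      (if p = id \<and> g = restrict id {0..<n} then 1 else 0)"
    if p: "p permutes {0..<n}" and g: "g \<in> {0..<n} \<rightarrow>\<^sub>E {0..<n}" for p g
  proof (cases "\<forall>r<n. p r = r \<and> g r = r")
    case True
    then have "p = id"
      using p by (auto simp: permutes_def fun_eq_iff)
    moreover have "g = restrict id {0..<n}"
      using True g by (auto simp: fun_eq_iff PiE_iff extensional_def)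
    ultimately show ?thesis
      using N by simp
  next
    case False
    then obtain r where r: "r < n" "p r \<noteq> r \<or> g r \<noteq> r"
      by auto
    have "g r < n" "p r < n"
      using g r(1) permutes_in_image[OF p, of r] by (auto simp: PiE_iff)
    then have "N (g r) (f r) (f (p r)) = 0"
      using N[of "g r" r "p r"] r by auto
    then have "(\<Prod>r\<in>{0..<n}. N (g r) (f r) (f (p r))) = 0"
      using r(1) by (intro prod_zero) auto
    then show ?thesis
      using r by auto
  qed
  have id: "restrict id {0..<n} \<in> {0..<n} \<rightarrow>\<^sub>E {0..<n}" "restrict id {0..<n} ` {0..<n} = {0..<n}"
    by auto
  have "mixed_det n f N = (\<Sum>p | p permutes {0..<n}. signof p *
     (\<Sum>g | g \<in> {0..<n} \<rightarrow>\<^sub>E {0..<n} \<and> g ` {0..<n} = {0..<n}.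
       if p = id \<and> g = restrict id {0..<n} then 1 else 0))"
    unfolding mixed_det_def by (intro sum.cong refl arg_cong2[where f = "(*)"] inner) simp_all
  also have "\<dots> = (\<Sum>p | p permutes {0..<n}. if p = id then 1 else 0)"
  proof (intro sum.cong refl)
    fix p :: "nat \<Rightarrow> nat"
    have fin: "finite {g. g \<in> {0..<n} \<rightarrow>\<^sub>E {0..<n} \<and> g ` {0..<n} = {0..<n}}"
      by (rule finite_subset[OF _ finite_PiE[of "{0..<n}" "\<lambda>_. {0..<n}"]]) auto
    then show "signof p * (\<Sum>g | g \<in> {0..<n} \<rightarrow>\<^sub>E {0..<n} \<and> g ` {0..<n} = {0..<n}.
       if p = id \<and> g = restrict id {0..<n} then 1 else 0) = (if p = id then 1 else (0::'k))"
    proof (cases "p = id")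
      case True
      have "restrict id {0..<n} \<in> {g. g \<in> {0..<n} \<rightarrow>\<^sub>E {0..<n} \<and> g ` {0..<n} = {0..<n}}"
        using id by blast
      then show ?thesis
        using True fin by (simp only: sign_id simp_thms if_True sum.delta) simp
    next
      case False
      then show ?thesis by (simp only: simp_thms if_False sum.neutral_const mult_zero_right)
    qed
  qed
  also have "\<dots> = 1"
    by (simp add: finite_permutations permutes_id)
  finally show ?thesis .
qed

lemma sum_fun_apply: "(\<Sum>k\<in>S. f k) a = (\<Sum>k\<in>S. f k a)"
  by (induction S rule: infinite_finite_induct) auto

text \<open>If every member of \<open>G\<close> were singular on \<open>J\<close>, polarization
  would make \<open>mixed_det\<close> vanish on tuples from \<open>G\<close>, and multilinearity on
  tuples from its span; the diagonal units give the value 1. The signs of the polarization stand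
  outside the determinants, so only plain sums of members of \<open>G\<close> have to be
  singular.\<close>

theorem exists_nonsingular_matrix:
  fixes G :: "('i \<Rightarrow> 'i \<Rightarrow> 'k::field) set"
  assumes J: "finite J" and G: "0 \<in> G" "\<And>N Y. N \<in> G \<Longrightarrow> Y \<in> G \<Longrightarrow> N + Y \<in> G"
    and units: "\<And>j. j \<in> J \<Longrightarrow> \<exists>N \<in> module.span mat_scale G.
      \<forall>i\<in>J. \<forall>l\<in>J. N i l = (if i = j \<and> l = j then 1 else 0)"
  shows "\<exists>N\<in>G. \<forall>y. (\<forall>i\<in>J. (\<Sum>l\<in>J. N i l * y l) = 0) \<longrightarrow> (\<forall>l\<in>J. y l = 0)"
proof (rule ccontr)
  assume "\<not> ?thesis"
  then have sing: "\<exists>y. (\<forall>i\<in>J. (\<Sum>l\<in>J. N i l * y l) = 0) \<and> (\<exists>l\<in>J. y l \<noteq> 0)" if "N \<in> G" for N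
    using that by blast
  interpret vector_space "mat_scale :: 'k \<Rightarrow> ('i \<Rightarrow> 'i \<Rightarrow> 'k) \<Rightarrow> _"
    by (rule vector_space_mat_scale)
  obtain f and n :: nat where f: "bij_betw f {0..<n} J"
    using ex_bij_betw_nat_finite[OF J] by blast
  have f_J: "f a \<in> J" if "a < n" for a
    using f that by (auto simp: bij_betw_def)
  have det0: "det (mat n n (\<lambda>(a, b). N (f a) (f b))) = 0" if "N \<in> G" for N
  proof -
    obtain y l where y: "\<And>i. i \<in> J \<Longrightarrow> (\<Sum>l\<in>J. N i l * y l) = 0" "l \<in> J" "y l \<noteq> 0"
      using sing[OF \<open>N \<in> G\<close>] by blast
    let ?A = "mat n n (\<lambda>(a, b). N (f a) (f b))" and ?v = "vec n (\<lambda>b. y (f b))"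
    obtain b where b: "b < n" "f b = l"
      using f y(2) by (auto simp: bij_betw_def)
    have "?v $ b \<noteq> 0\<^sub>v n $ b"
      using b y(3) by simp
    then have "?v \<noteq> 0\<^sub>v n"
      by metis
    moreover have "?A *\<^sub>v ?v = 0\<^sub>v n"
    proof (rule eq_vecI)
      fix a assume "a < dim_vec (0\<^sub>v n :: 'k vec)"
      then have a: "a < n" by simp
      then have "(?A *\<^sub>v ?v) $ a = (\<Sum>b\<in>{0..<n}. N (f a) (f b) * y (f b))"
        by (simp add: scalar_prod_def)
      also have "\<dots> = (\<Sum>l\<in>J. N (f a) l * y l)"
        by (rule sum.reindex_bij_betw[OF f])
      finally show "(?A *\<^sub>v ?v) $ a = 0\<^sub>v n $ a"
        using y(1)[OF f_J[OF a]] a by simp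
    qed simp
    ultimately show ?thesis
      by (subst det_0_iff_vec_prod_zero_field[of _ n]) (auto intro!: exI[of _ ?v])
  qed
  \<comment> \<open>The arguments are moved from \<open>G\<close> to its span one at a time;
    \<open>m\<close> counts those already moved.\<close>
  have vanish: "mixed_det n f N = 0"
    if "m \<le> n" "\<And>k. k < m \<Longrightarrow> N k \<in> span G" "\<And>k. m \<le> k \<Longrightarrow> k < n \<Longrightarrow> N k \<in> G" for m N
    using that
  proof (induction m arbitrary: N)
    case 0
    \<comment> \<open>The empty \<open>S\<close> occurs in the polarization as well; it is covered
      by \<open>0 \<in> G\<close>.\<close>
    have "(\<Sum>k\<in>S. N k) \<in> G" if "S \<subseteq> {0..<n}" for S
    proof -
      have "finite S"
        using that by (rule finite_subset) simp
      then show ?thesis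
        using that by (induction S rule: finite_induct) (auto simp: G 0)
    qed
    then have "det (mat n n (\<lambda>(a, b). \<Sum>k\<in>S. N k (f a) (f b))) = 0" if "S \<subseteq> {0..<n}" for S
      using det0[of "\<Sum>k\<in>S. N k"] that by (simp add: sum_fun_apply)
    then have "(- 1) ^ n * mixed_det n f N = 0"
      by (subst mixed_det_polarization[symmetric]) (auto intro!: sum.neutral)
    then show ?case by simp
  next
    case (Suc m)
    have "mixed_det n f (N(m := Y)) = 0" if "Y \<in> G" for Y
      using Suc.prems that by (intro Suc.IH) auto
    then have "span G \<subseteq> {Y. mixed_det n f (N(m := Y)) = 0}"
      using Suc.prems(1) by (intro span_minimal subspace_mixed_det_zero) auto
    then have "mixed_det n f (N(m := N m)) = 0"
      using Suc.prems(2)[of m] by blast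
    then show ?case by simp
  qed
  obtain U where U: "\<And>j. j \<in> J \<Longrightarrow> U j \<in> span G"
    "\<And>j i l. j \<in> J \<Longrightarrow> i \<in> J \<Longrightarrow> l \<in> J \<Longrightarrow> U j i l = (if i = j \<and> l = j then 1 else 0)"
    using units by metis
  have inj: "f a = f b \<longleftrightarrow> a = b" if "a < n" "b < n" for a b
    using f that by (auto simp: bij_betw_def inj_on_def)
  have "mixed_det n f (\<lambda>k. U (f k)) = 1"
    by (rule mixed_det_units) (simp add: U f_J inj)
  moreover have "mixed_det n f (\<lambda>k. U (f k)) = 0"
    by (rule vanish[of n]) (simp_all add: U f_J)
  ultimately show False by simp
qed

section \<open>Algebras of operators over an algebraically closed field\<close>

text \<open>The operator p(T), evaluated at a vector by Horner's scheme.\<close>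

definition poly_op :: "('a::zero \<Rightarrow> 'b \<Rightarrow> 'b::ab_group_add) \<Rightarrow> ('b \<Rightarrow> 'b) \<Rightarrow> 'a poly \<Rightarrow> 'b \<Rightarrow> 'b" where
  "poly_op scale T p = fold_coeffs (\<lambda>a S v. scale a v + T (S v)) p (\<lambda>_. 0)"

locale linear_operator = vector_space scale
  for scale :: "'a::field \<Rightarrow> 'b::ab_group_add \<Rightarrow> 'b" +
  fixes T :: "'b \<Rightarrow> 'b"
  assumes linear: "Vector_Spaces.linear scale scale T"
begin

abbreviation ev :: "'a poly \<Rightarrow> 'b \<Rightarrow> 'b" where "ev \<equiv> poly_op scale T"

lemma T_add: "T (x + y) = T x + T y" and T_scale: "T (scale c x) = scale c (T x)"
  using linear by (auto simp: Vector_Spaces.linear_iff)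

lemma T_zero: "T 0 = 0"
  using T_scale[of 0 0] by simp

lemma poly_op_0 [simp]: "ev 0 v = 0"
  by (simp add: poly_op_def)

lemma poly_op_pCons [simp]: "ev (pCons a p) v = scale a v + T (ev p v)"
  \<comment> \<open>\<open>pCons 0 0\<close> is special because its coefficient list is empty; there
    the equation rests on \<open>T 0 = 0\<close>.\<close>
  by (cases "a = 0 \<and> p = 0") (auto simp: poly_op_def T_zero)

lemma poly_op_add: "ev (p + q) v = ev p v + ev q v"
  by (induction p q rule: poly_induct2) (simp_all add: T_add scale_left_distrib)

lemma poly_op_smult: "ev (smult c p) v = scale c (ev p v)"
  by (induction p) (simp_all add: T_scale scale_right_distrib)

lemma poly_op_mult: "ev (p * q) v = ev p (ev q v)"
  by (induction p) (simp_all add: poly_op_add poly_op_smult)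

lemma poly_op_add_right: "ev p (x + y) = ev p x + ev p y"
  by (induction p) (simp_all add: T_add scale_right_distrib)

lemma poly_op_scale_right: "ev p (scale c x) = scale c (ev p x)"
  by (induction p) (simp_all add: T_scale scale_right_distrib mult.commute)

lemma poly_op_at_0 [simp]: "ev p 0 = 0"
  by (induction p) (simp_all add: T_zero)

lemma poly_op_sum: "ev (sum f I) v = (\<Sum>i\<in>I. ev (f i) v)"
  by (induction I rule: infinite_finite_induct) (simp_all add: poly_op_add)

lemma poly_op_monom: "ev (monom c n) v = scale c ((T ^^ n) v)"
  by (induction n) (simp_all add: monom_0 monom_Suc T_zero T_scale)

text \<open>More than \<open>card C\<close> iterates of \<open>v\<close> in the span of
  \<open>C\<close> are linearly dependent, and a dependence relation is a polynomial. Since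
  dependence is a property of sets, coinciding iterates are treated separately, by a difference of
  two monomials.\<close>

lemma poly_op_annihilates_vector:
  assumes "finite C" "\<And>n. (T ^^ n) v \<in> span C"
  shows "\<exists>p. p \<noteq> 0 \<and> ev p v = 0"
proof (cases "inj (\<lambda>n. (T ^^ n) v)")
  case False
  then obtain i j where ij: "(T ^^ i) v = (T ^^ j) v" "i \<noteq> j"
    by (auto simp: inj_def)
  let ?p = "monom 1 i + monom (- 1) j :: 'a poly"
  have "coeff ?p i \<noteq> coeff 0 i"
    using ij by simp
  then have "?p \<noteq> 0"
    by metis
  moreover have "ev ?p v = 0"
    using ij by (simp add: poly_op_add poly_op_monom)
  ultimately show ?thesis by blast
next
  case True
  let ?f = "\<lambda>n. (T ^^ n) v"
  let ?P = "?f ` {..card C}"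
  have inj: "inj_on ?f {..card C}"
    using True by (rule inj_on_subset) simp
  have "card ?P = Suc (card C)"
    using inj by (simp add: card_image)
  then have "dependent ?P"
    using independent_span_bound[OF assms(1), of ?P] assms(2) by fastforce
  then obtain u n where u: "(\<Sum>w\<in>?P. scale (u w) w) = 0" "n \<le> card C" "u (?f n) \<noteq> 0"
    by (auto simp: dependent_finite)
  let ?p = "\<Sum>i\<le>card C. monom (u (?f i)) i"
  have "coeff ?p n = u (?f n)"
    using u(2) by (simp add: coeff_sum)
  then have "?p \<noteq> 0"
    using u(3) by (metis coeff_0)
  moreover have "ev ?p v = 0"
    using u(1) inj by (simp add: poly_op_sum poly_op_monom sum.reindex)
  ultimately show ?thesis by blast
qed

text \<open>Polynomials in \<open>T\<close> commute, so a product of annihilators of single vectors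
  annihilates all of them.\<close>

lemma poly_op_annihilates_finite:
  assumes "finite B" "\<And>v. v \<in> B \<Longrightarrow> \<exists>p. p \<noteq> 0 \<and> ev p v = 0"
  shows "\<exists>p. p \<noteq> 0 \<and> (\<forall>v\<in>B. ev p v = 0)"
  using assms
proof (induction B rule: finite_induct)
  case empty
  show ?case by (intro exI[of _ 1]) simp
next
  case (insert b B)
  obtain p where p: "p \<noteq> 0" "ev p b = 0"
    using insert.prems by auto
  obtain q where q: "q \<noteq> 0" "\<forall>v\<in>B. ev q v = 0"
    using insert by auto
  have "ev (q * p) b = 0"
    by (simp add: poly_op_mult p(2))
  moreover have "ev (p * q) v = 0" if "v \<in> B" for v
    using q(2) that by (simp add: poly_op_mult)
  ultimately show ?case
    using p(1) q(1) by (intro exI[of _ "p * q"]) (auto simp: mult.commute)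
qed

text \<open>The kernel of p(T) is a subspace, so it suffices to annihilate a basis of
  \<open>U\<close>, which is finite.\<close>

lemma poly_op_annihilates_subspace:
  assumes "finite C" "subspace U" "U \<subseteq> span C" "\<And>v. v \<in> U \<Longrightarrow> T v \<in> U"
  shows "\<exists>p. p \<noteq> 0 \<and> (\<forall>v\<in>U. ev p v = 0)"
proof -
  obtain B where B: "B \<subseteq> U" "independent B" "U \<subseteq> span B"
    by (rule maximal_independent_subset)
  have "finite B"
    using independent_span_bound[OF assms(1) B(2)] B(1) assms(3) by blast
  have pow: "(T ^^ n) v \<in> U" if "v \<in> U" for n v
    using that by (induction n) (auto intro: assms(4))
  obtain p where p: "p \<noteq> 0" "\<forall>v\<in>B. ev p v = 0"
    using poly_op_annihilates_finite[OF \<open>finite B\<close>]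
      poly_op_annihilates_vector[OF assms(1)] pow B(1) assms(3) by blast
  have "ev p v = 0" if "v \<in> span B" for v
    using that
    by (induction rule: span_induct_alt) (simp_all add: p(2) poly_op_add_right poly_op_scale_right)
  then show ?thesis
    using p(1) B(3) by blast
qed

end


section \<open>Operator algebras, submodules and eigenvectors of quotients\<close>

text \<open>The module under study is \<open>E\<close>, not the whole type \<open>'v\<close>: the
  operators act on an ambient space that may be infinite-dimensional, and \<open>C\<close> bounds
  the dimension of \<open>E\<close>.\<close>

locale operator_algebra = vector_space scale
  for scale :: "'k::alg_closed_field \<Rightarrow> 'v::ab_group_add \<Rightarrow> 'v" +
  fixes \<A> :: "('v \<Rightarrow> 'v) set" and E C :: "'v set"
  assumes linear: "T \<in> \<A> \<Longrightarrow> Vector_Spaces.linear scale scale T"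
    and ident: "(\<lambda>v. v) \<in> \<A>"
    and comp: "S \<in> \<A> \<Longrightarrow> T \<in> \<A> \<Longrightarrow> (\<lambda>v. S (T v)) \<in> \<A>"
    and add: "S \<in> \<A> \<Longrightarrow> T \<in> \<A> \<Longrightarrow> (\<lambda>v. S v + T v) \<in> \<A>"
    and scale: "T \<in> \<A> \<Longrightarrow> (\<lambda>v. scale c (T v)) \<in> \<A>"
    and E_subspace: "subspace E"
    and E_invariant: "T \<in> \<A> \<Longrightarrow> v \<in> E \<Longrightarrow> T v \<in> E"
    and finite_C: "finite C"
    and E_span: "E \<subseteq> span C"
begin

abbreviation ev :: "('v \<Rightarrow> 'v) \<Rightarrow> 'k poly \<Rightarrow> 'v \<Rightarrow> 'v" where "ev \<equiv> poly_op scale"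

lemma linear_operator: "T \<in> \<A> \<Longrightarrow> linear_operator scale T"
  by (simp add: linear linear_operator_def linear_operator_axioms_def vector_space_axioms)

lemma op_add: "T \<in> \<A> \<Longrightarrow> T (x + y) = T x + T y"
  and op_scale: "T \<in> \<A> \<Longrightarrow> T (scale c x) = scale c (T x)"
  using linear by (auto simp: Vector_Spaces.linear_iff)

lemma op_zero: "T \<in> \<A> \<Longrightarrow> T 0 = 0"
  using op_scale[of T 0 0] by simp

lemma op_diff: "T \<in> \<A> \<Longrightarrow> T (x - y) = T x - T y"
  using op_add[of T "x - y" y] by (simp add: algebra_simps)

lemma op_sum: "T \<in> \<A> \<Longrightarrow> T (\<Sum>i\<in>I. f i) = (\<Sum>i\<in>I. T (f i))"
  by (induction I rule: infinite_finite_induct) (simp_all add: op_zero op_add)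

lemma poly_op_mem: "T \<in> \<A> \<Longrightarrow> ev T p \<in> \<A>"
proof (induction p)
  case 0
  have "ev T 0 = (\<lambda>v. scale 0 v)"
    by (simp add: poly_op_def)
  then show ?case
    using scale[OF ident, of 0] by simp
next
  case (pCons a p)
  have "ev T (pCons a p) = (\<lambda>v. scale a v + T (ev T p v))"
    by (rule ext) (rule linear_operator.poly_op_pCons[OF linear_operator[OF pCons.prems]])
  then show ?case
    using add[OF scale[OF ident, of a] comp[OF pCons.prems pCons.IH[OF pCons.prems]]] by simp
qed

definition invariant :: "'v set \<Rightarrow> bool" where
  "invariant U \<longleftrightarrow> subspace U \<and> U \<subseteq> E \<and> (\<forall>T\<in>\<A>. \<forall>v\<in>U. T v \<in> U)"

lemma invariantD:
  assumes "invariant U"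
  shows invariant_subspace: "subspace U" and invariant_subset: "U \<subseteq> E"
    and invariant_op: "\<And>T v. T \<in> \<A> \<Longrightarrow> v \<in> U \<Longrightarrow> T v \<in> U"
    and invariant_zero: "0 \<in> U"
    and invariant_add: "\<And>u v. u \<in> U \<Longrightarrow> v \<in> U \<Longrightarrow> u + v \<in> U"
    and invariant_diff: "\<And>u v. u \<in> U \<Longrightarrow> v \<in> U \<Longrightarrow> u - v \<in> U"
    and invariant_scale: "\<And>c u. u \<in> U \<Longrightarrow> scale c u \<in> U"
  using assms
  by (auto simp: invariant_def subspace_0 subspace_add subspace_diff subspace_scale)

text \<open>A simple quotient V/W is represented by the pair of submodules \<open>(W, V)\<close>;
  equations in V/W are written as membership of a difference in \<open>W\<close>.\<close>

definition composition_factor :: "'v set \<Rightarrow> 'v set \<Rightarrow> bool" where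
  "composition_factor W V \<longleftrightarrow> invariant W \<and> invariant V \<and> W \<subset> V \<and>
     (\<forall>U. invariant U \<longrightarrow> W \<subseteq> U \<longrightarrow> U \<subseteq> V \<longrightarrow> U = W \<or> U = V)"

text \<open>For an operator preserving both \<open>W\<close> and \<open>V\<close> this is
  injectivity of the induced map on V/W.\<close>

definition injective_mod :: "('v \<Rightarrow> 'v) \<Rightarrow> 'v set \<Rightarrow> 'v set \<Rightarrow> bool" where
  "injective_mod T W V \<longleftrightarrow> (\<forall>v\<in>V. T v \<in> W \<longrightarrow> v \<in> W)"

text \<open>Take \<open>p\<close> of least degree with p(S)u in \<open>W\<close>. It is not
  constant, so it has a root \<open>c\<close>, and p = (X - c) q makes q(S)u an eigenvector modulo
  \<open>W\<close>. The explicit form q(S)u keeps the eigenvector within reach of left ideals: if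
  \<open>u\<close> is \<open>T b\<close>, it is the value at \<open>b\<close> of q(S) composed with
  \<open>T\<close>.\<close>

lemma eigenvector_mod:
  assumes S: "S \<in> \<A>" and W: "invariant W" and u: "u \<in> E" "u \<notin> W"
  obtains q c where "ev S q u \<notin> W" "S (ev S q u) - scale c (ev S q u) \<in> W"
proof -
  interpret S: linear_operator scale S
    by (rule linear_operator[OF S])
  have "(S ^^ n) u \<in> E" for n
    by (induction n) (simp_all add: u(1) E_invariant S)
  then have "\<exists>p. p \<noteq> 0 \<and> ev S p u = 0"
    using E_span by (intro S.poly_op_annihilates_vector[OF finite_C]) auto
  then have "\<exists>p. p \<noteq> 0 \<and> ev S p u \<in> W"
    using invariant_zero[OF W] by metis
  then obtain p where p: "p \<noteq> 0" "ev S p u \<in> W"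
    and min: "\<And>q. q \<noteq> 0 \<Longrightarrow> ev S q u \<in> W \<Longrightarrow> degree p \<le> degree q"
    using ex_has_least_nat[of "\<lambda>p. p \<noteq> 0 \<and> ev S p u \<in> W" _ degree] by blast
  have "degree p > 0"
  proof (rule ccontr)
    assume "\<not> degree p > 0"
    then obtain a where a: "p = [:a:]"
      by (auto elim: degree_eq_zeroE)
    then have "scale (inverse a) (scale a u) \<in> W"
      using p(2) invariant_scale[OF W] by (simp add: S.T_zero del: scale_scale)
    then show False
      using a p(1) u(2) by simp
  qed
  then obtain c where "poly p c = 0"
    using alg_closed_imp_poly_has_root by blast
  then obtain q where q: "p = [:- c, 1:] * q"
    by (auto simp: poly_eq_0_iff_dvd elim: dvdE)
  then have "q \<noteq> 0" "degree q < degree p"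
    using p(1) by (auto simp: degree_mult_eq simp del: mult_pCons_left)
  then have "ev S q u \<notin> W"
    using min by fastforce
  moreover have "S (ev S q u) - scale c (ev S q u) \<in> W"
    using p(2) unfolding q S.poly_op_mult by (simp add: S.T_zero)
  ultimately show thesis
    by (rule that)
qed

section \<open>Two-sided ideals and Jacobson density\<close>

text \<open>Closure under scalars is implied, because \<A> contains the scalar operators.\<close>

definition two_sided_ideal :: "('v \<Rightarrow> 'v) set \<Rightarrow> bool" where
  "two_sided_ideal J \<longleftrightarrow> J \<subseteq> \<A> \<and> (\<lambda>_. 0) \<in> J \<and>
     (\<forall>S\<in>J. \<forall>T\<in>J. (\<lambda>v. S v + T v) \<in> J) \<and>
     (\<forall>S\<in>\<A>. \<forall>T\<in>J. (\<lambda>v. S (T v)) \<in> J \<and> (\<lambda>v. T (S v)) \<in> J)"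

lemma two_sided_idealD:
  assumes "two_sided_ideal J"
  shows ideal_mem: "\<And>T. T \<in> J \<Longrightarrow> T \<in> \<A>"
    and ideal_zero: "(\<lambda>_. 0) \<in> J"
    and ideal_add: "\<And>S T. S \<in> J \<Longrightarrow> T \<in> J \<Longrightarrow> (\<lambda>v. S v + T v) \<in> J"
    and ideal_left: "\<And>S T. S \<in> \<A> \<Longrightarrow> T \<in> J \<Longrightarrow> (\<lambda>v. S (T v)) \<in> J"
    and ideal_right: "\<And>S T. S \<in> \<A> \<Longrightarrow> T \<in> J \<Longrightarrow> (\<lambda>v. T (S v)) \<in> J"
  using assms by (auto simp: two_sided_ideal_def)

lemma ideal_scale:
  assumes "two_sided_ideal J" "T \<in> J"
  shows "(\<lambda>v. scale c (T v)) \<in> J"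
  using ideal_left[OF assms(1) scale[OF ident] assms(2)] .

lemma ideal_diff:
  assumes "two_sided_ideal J" "S \<in> J" "T \<in> J"
  shows "(\<lambda>v. S v - T v) \<in> J"
  using ideal_add[OF assms(1,2) ideal_scale[OF assms(1,3), of "- 1"]] by simp

text \<open>As V/W is simple and \<open>J\<close> acts on it nontrivially, the submodule annihilated
  by \<open>J\<close> is zero in V/W. Hence \<open>J\<close> does not annihilate \<open>v\<close>,
  and the submodule generated by the images of \<open>v\<close> under \<open>J\<close> is all of
  V/W.\<close>

lemma ideal_transitive:
  assumes J: "two_sided_ideal J" and WV: "composition_factor W V"
    and act: "T0 \<in> J" "v0 \<in> V" "T0 v0 \<notin> W"
    and v: "v \<in> V" "v \<notin> W" and u: "u \<in> V"
  obtains T where "T \<in> J" "T v - u \<in> W"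
proof -
  have W: "invariant W" and V: "invariant V" and sub: "W \<subseteq> V"
    and simple: "\<And>U. invariant U \<Longrightarrow> W \<subseteq> U \<Longrightarrow> U \<subseteq> V \<Longrightarrow> U = W \<or> U = V"
    using WV by (auto simp: composition_factor_def)
  note Js = ideal_mem[OF J] ideal_zero[OF J] ideal_add[OF J] ideal_left[OF J] ideal_right[OF J]
  \<comment> \<open>The annihilator of \<open>J\<close> in V/W; it is a submodule because
    \<open>J\<close> absorbs operators on the right.\<close>
  define K where "K = {x \<in> V. \<forall>T\<in>J. T x \<in> W}"
  have "invariant K"
    unfolding invariant_def
  proof (intro conjI ballI)
    show "subspace K"
      using invariantD[OF W] invariantD[OF V] Js(1)
      by (auto simp: K_def subspace_def op_zero op_add op_scale)
    show "K \<subseteq> E"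
      using invariant_subset[OF V] by (auto simp: K_def)
    show "T x \<in> K" if "T \<in> \<A>" "x \<in> K" for T x
      using that invariant_op[OF V] Js(5) by (force simp: K_def)
  qed
  moreover have "W \<subseteq> K"
    using sub invariant_op[OF W] Js(1) by (auto simp: K_def)
  moreover have "K \<subseteq> V" "K \<noteq> V"
    using act by (auto simp: K_def)
  ultimately have "K = W"
    using simple by blast
  then obtain T1 where T1: "T1 \<in> J" "T1 v \<notin> W"
    using v by (auto simp: K_def)
  \<comment> \<open>This is J v + W, a submodule because \<open>J\<close> absorbs operators on the
    left.\<close>
  define Q where "Q = {x \<in> V. \<exists>T\<in>J. T v - x \<in> W}"
  have "invariant Q"
    unfolding invariant_def
  proof (intro conjI ballI)
    show "subspace Q"
    proof (rule subspaceI)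
      show "0 \<in> Q"
        using Js(2) invariant_zero[OF W] invariant_zero[OF V] by (force simp: Q_def)
    next
      fix x y assume "x \<in> Q" "y \<in> Q"
      then obtain S T where "S \<in> J" "S v - x \<in> W" "T \<in> J" "T v - y \<in> W" "x \<in> V" "y \<in> V"
        by (auto simp: Q_def)
      then show "x + y \<in> Q"
        using invariant_add[OF W, of "S v - x" "T v - y"] invariant_add[OF V] Js(3)[of S T]
        by (force simp: Q_def algebra_simps)
    next
      fix c x assume "x \<in> Q"
      then obtain S where "S \<in> J" "S v - x \<in> W" "x \<in> V"
        by (auto simp: Q_def)
      then show "scale c x \<in> Q"
        using invariant_scale[OF W, of "S v - x" c] invariant_scale[OF V] ideal_scale[OF J, of S c]
        by (force simp: Q_def scale_right_diff_distrib)
    qed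
    show "Q \<subseteq> E"
      using invariant_subset[OF V] by (auto simp: Q_def)
    show "T x \<in> Q" if T: "T \<in> \<A>" and x: "x \<in> Q" for T x
    proof -
      obtain S where S: "S \<in> J" "S v - x \<in> W" "x \<in> V"
        using x by (auto simp: Q_def)
      have "T (S v) - T x \<in> W"
        using invariant_op[OF W T S(2)] by (simp add: op_diff T)
      then show ?thesis
        using Js(4)[OF T S(1)] invariant_op[OF V T S(3)] by (auto simp: Q_def)
    qed
  qed
  moreover have "W \<subseteq> Q"
  proof
    fix x assume "x \<in> W"
    then show "x \<in> Q"
      using sub Js(2) invariant_diff[OF W invariant_zero[OF W]] by (force simp: Q_def)
  qed
  moreover have "Q \<subseteq> V"
    by (auto simp: Q_def)
  moreover have "T1 v \<in> Q"
    using T1 v invariant_op[OF V] Js(1) invariant_zero[OF W] by (force simp: Q_def)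
  ultimately have "Q = V"
    using simple T1(2) by blast
  then show thesis
    using u that by (auto simp: Q_def)
qed

text \<open>
  In the induction step, an operator \<open>S\<close> of \<open>J\<close> sending \<open>T b\<close> to \<open>T v\<close> acts on \<open>T b\<close> like the
  endomorphism \<open>T b \<mapsto> T v\<close> of Schur's lemma; an eigenvector of \<open>S\<close> shows that this is a scalar \<open>c\<close>,
  and then \<open>v - c b\<close> is covered by the induction hypothesis.
\<close>

lemma density:
  assumes J: "two_sided_ideal J" and WV: "composition_factor W V"
    and act: "T0 \<in> J" "v0 \<in> V" "T0 v0 \<notin> W"
    and B: "finite B" "B \<subseteq> V" and v: "v \<in> V" "v \<notin> span (B \<union> W)"
  shows "\<exists>T\<in>J. (\<forall>b\<in>B. T b \<in> W) \<and> T v \<notin> W"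
  using B v
proof (induction B arbitrary: v rule: finite_induct)
  case empty
  then have "v \<notin> W"
    using span_base by force
  have "T0 v0 \<in> V"
    using WV act ideal_mem[OF J] by (auto simp: composition_factor_def invariant_op)
  obtain T where T: "T \<in> J" "T v - T0 v0 \<in> W"
    using ideal_transitive[OF J WV act \<open>v \<in> V\<close> \<open>v \<notin> W\<close> \<open>T0 v0 \<in> V\<close>] .
  have "T v \<notin> W"
  proof
    assume "T v \<in> W"
    then show False
      using invariant_diff[of W "T v" "T v - T0 v0"] WV T(2) act(3)
      by (simp add: composition_factor_def)
  qed
  then show ?case
    using T(1) by auto
next
  case (insert b B)
  have W: "invariant W" and V: "invariant V"
    using WV by (auto simp: composition_factor_def)
  have b: "b \<in> V" and BV: "B \<subseteq> V"
    using insert.prems by auto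
  have vB: "v \<notin> span (B \<union> W)"
    using insert.prems(3) span_mono[of "B \<union> W" "insert b B \<union> W"] by auto
  \<comment> \<open>The left ideal of those operators in \<open>J\<close> that annihilate
    \<open>B\<close> modulo \<open>W\<close>.\<close>
  define L where "L = {T \<in> J. \<forall>x\<in>B. T x \<in> W}"
  have L_J: "T \<in> L \<Longrightarrow> T \<in> J" for T
    by (simp add: L_def)
  have L_A: "T \<in> L \<Longrightarrow> T \<in> \<A>" for T
    using L_J ideal_mem[OF J] by blast
  have L_left: "(\<lambda>x. S (T x)) \<in> L" if "S \<in> \<A>" "T \<in> L" for S T
    using that invariant_op[OF W] ideal_left[OF J] by (auto simp: L_def)
  have L_diff: "(\<lambda>x. S x - T x) \<in> L" if "S \<in> L" "T \<in> L" for S T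
    using that ideal_diff[OF J] invariant_diff[OF W] by (auto simp: L_def)
  show ?case
  proof (rule ccontr)
    assume "\<not> ?case"
    \<comment> \<open>Modulo \<open>W\<close>, the assignment of \<open>T v\<close> to
      \<open>T b\<close> for \<open>T\<close> in \<open>L\<close> is thus well defined and commutes
      with \<A>: this is the endomorphism that Schur's lemma would treat.\<close>
    then have kill: "T v \<in> W" if "T \<in> L" "T b \<in> W" for T
      using that by (auto simp: L_def)
    have "\<exists>T\<in>L. T v \<notin> W"
      using insert.IH[OF BV insert.prems(2) vB] by (auto simp: L_def)
    then obtain T where T: "T \<in> L" "T b \<notin> W"
      using kill by blast
    have TbV: "T b \<in> V" and TvV: "T v \<in> V"
      using invariant_op[OF V L_A[OF T(1)]] b insert.prems(2) by auto
    obtain S where S: "S \<in> J" "S (T b) - T v \<in> W"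
      using ideal_transitive[OF J WV act TbV T(2) TvV] .
    have S_A: "S \<in> \<A>"
      using ideal_mem[OF J S(1)] .
    have "T b \<in> E"
      using TbV invariant_subset[OF V] by auto
    from eigenvector_mod[OF S_A W this T(2)] obtain q c where
      q: "ev S q (T b) \<notin> W" "S (ev S q (T b)) - scale c (ev S q (T b)) \<in> W" .
    define Q where "Q = (\<lambda>x. ev S q (T x))"
    have qA: "ev S q \<in> \<A>"
      by (rule poly_op_mem[OF S_A])
    have Q_L: "Q \<in> L"
      unfolding Q_def by (rule L_left[OF qA T(1)])
    have comm: "ev S q (S x) = S (ev S q x)" for x
      using linear_operator.poly_op_mult[OF linear_operator[OF S_A], of q "[:0, 1:]" x]
        linear_operator.poly_op_mult[OF linear_operator[OF S_A], of "[:0, 1:]" q x]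
      by (simp add: mult.commute linear_operator.poly_op_pCons[OF linear_operator[OF S_A]]
          linear_operator.poly_op_0[OF linear_operator[OF S_A]] op_zero[OF S_A])
    have "ev S q (S (T b) - T v) \<in> W"
      by (rule invariant_op[OF W qA S(2)])
    then have "S (Q b) - Q v \<in> W"
      by (simp add: Q_def op_diff[OF qA] comm)
    moreover have "S (Q b) - scale c (Q b) \<in> W"
      using q(2) by (simp add: Q_def)
    ultimately have "(S (Q b) - scale c (Q b)) - (S (Q b) - Q v) \<in> W"
      by (rule invariant_diff[OF W, rotated])
    then have Qv: "Q v - scale c (Q b) \<in> W"
      by simp
    have QbV: "Q b \<in> V"
      using invariant_op[OF V L_A[OF Q_L] b] .
    have QbW: "Q b \<notin> W"
      using q(1) by (simp add: Q_def)
    \<comment> \<open>Choose \<open>R\<close> in \<open>J\<close> with R Q b = P b modulo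
      \<open>W\<close>. Then R Q - P lies in \<open>L\<close> and annihilates \<open>b\<close>,
      hence also \<open>v\<close>, so that P v = R Q v = c R Q b = c P b modulo
      \<open>W\<close>.\<close>
    have "P (v - scale c b) \<in> W" if P: "P \<in> L" for P
    proof -
      have PbV: "P b \<in> V"
        using invariant_op[OF V L_A[OF P] b] .
      obtain R where R: "R \<in> J" "R (Q b) - P b \<in> W"
        using ideal_transitive[OF J WV act QbV QbW PbV] .
      have RA: "R \<in> \<A>"
        using ideal_mem[OF J R(1)] .
      have "R (Q v) - P v \<in> W"
        using kill[OF L_diff[OF L_left[OF RA Q_L] P] R(2)] .
      from invariant_add[OF W invariant_diff[OF W invariant_op[OF W RA Qv] this]
          invariant_scale[OF W R(2), of c]]
      have "R (Q v - scale c (Q b)) - (R (Q v) - P v) + scale c (R (Q b) - P b) \<in> W" .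
      then show ?thesis
        using L_A[OF P] RA by (simp add: op_diff op_scale scale_right_diff_distrib)
    qed
    moreover have "v - scale c b \<in> V"
      using insert.prems(2) b by (intro invariant_diff[OF V] invariant_scale[OF V])
    ultimately have "v - scale c b \<in> span (B \<union> W)"
      using insert.IH[OF BV, of "v - scale c b"] by (auto simp: L_def)
    then have "v - scale c b \<in> span (insert b B \<union> W)"
      using span_mono[of "B \<union> W" "insert b B \<union> W"] by auto
    moreover have "scale c b \<in> span (insert b B \<union> W)"
      by (intro span_scale span_base) simp
    ultimately have "(v - scale c b) + scale c b \<in> span (insert b B \<union> W)"
      by (rule span_add)
    then show False
      using insert.prems(3) by simp
  qed
qed

text \<open>Density gives an operator annihilating \<open>B\<close> but not \<open>b\<close>;
  transitivity carries the image of \<open>b\<close> back to \<open>b\<close>.\<close>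

lemma dual_operator:
  assumes J: "two_sided_ideal J" and WV: "composition_factor W V"
    and act: "T0 \<in> J" "v0 \<in> V" "T0 v0 \<notin> W"
    and B: "finite B" "B \<subseteq> V" and b: "b \<in> V" "b \<notin> span (B \<union> W)"
  obtains T where "T \<in> J" "T b - b \<in> W" "\<And>x. x \<in> B \<Longrightarrow> T x \<in> W"
proof -
  have W: "invariant W" and V: "invariant V"
    using WV by (auto simp: composition_factor_def)
  obtain T where T: "T \<in> J" "\<forall>x\<in>B. T x \<in> W" "T b \<notin> W"
    using density[OF assms] by blast
  have "T b \<in> V"
    using invariant_op[OF V ideal_mem[OF J T(1)] b(1)] .
  then obtain R where R: "R \<in> J" "R (T b) - b \<in> W"
    using ideal_transitive[OF J WV act _ T(3) b(1)] by blast
  have "(\<lambda>x. R (T x)) \<in> J"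
    by (rule ideal_left[OF J ideal_mem[OF J R(1)] T(1)])
  moreover have "R (T x) \<in> W" if "x \<in> B" for x
    using T(2) that invariant_op[OF W ideal_mem[OF J R(1)]] by blast
  ultimately show thesis
    using that R(2) by blast
qed

section \<open>Irredundant families of composition factors\<close>

text \<open>The ambient space may be infinite-dimensional, so the comparison is made inside
  \<open>E\<close>, whose independent subsets are finite.\<close>

lemma dim_strict_mono:
  assumes "subspace U" "subspace V" "U \<subset> V" "V \<subseteq> E"
  shows "dim U < dim V"
proof -
  obtain B where B: "B \<subseteq> U" "independent B" "U \<subseteq> span B" "card B = dim U"
    by (rule basis_exists)
  obtain v where v: "v \<in> V" "v \<notin> U"
    using assms(3) by auto
  have "span B = U"
    using B assms(1) span_minimal by blast
  then have ind: "independent (insert v B)"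
    using B(2) v(2) by (intro independent_insertI) auto
  obtain D where D: "insert v B \<subseteq> D" "D \<subseteq> V" "independent D" "V \<subseteq> span D"
    using maximal_independent_subset_extend[OF _ ind, of V] B(1) assms(3) v(1) by blast
  have "finite D"
    using independent_span_bound[OF finite_C D(3)] D(2) assms(4) E_span by blast
  have "v \<notin> B"
    using B(1) v(2) by auto
  then have "B \<subset> D"
    using D(1) by auto
  then have "card B < card D"
    using \<open>finite D\<close> by (rule psubset_card_mono[rotated])
  then show ?thesis
    using basis_card_eq_dim[OF D(2,4,3)] B(4) by simp
qed

text \<open>What is retained of a composition series: its test for trivial kernel. In this form
  members can be discarded, for instance one of two isomorphic factors.\<close>

definition detects_kernel :: "('v set \<times> 'v set) set \<Rightarrow> 'v set \<Rightarrow> bool" where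
  "detects_kernel \<F> V \<longleftrightarrow> finite \<F> \<and> (\<forall>W U. (W, U) \<in> \<F> \<longrightarrow> composition_factor W U) \<and>
     (\<forall>T\<in>\<A>. (\<forall>W U. (W, U) \<in> \<F> \<longrightarrow> injective_mod T W U) \<longrightarrow> (\<forall>v\<in>V. T v = 0 \<longrightarrow> v = 0))"

lemma detects_kernelD:
  assumes "detects_kernel \<F> V"
  shows detects_kernel_finite: "finite \<F>"
    and detects_kernel_factor: "\<And>W U. (W, U) \<in> \<F> \<Longrightarrow> composition_factor W U"
    and detects_kernel_zero: "\<And>T v. T \<in> \<A> \<Longrightarrow> (\<And>W U. (W, U) \<in> \<F> \<Longrightarrow> injective_mod T W U) \<Longrightarrow>
      v \<in> V \<Longrightarrow> T v = 0 \<Longrightarrow> v = 0"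
  using assms unfolding detects_kernel_def by simp_all

text \<open>Descend to a maximal proper submodule \<open>W\<close> of \<open>V\<close>, found by its
  dimension. An operator injective on V/W has its kernel in \<open>V\<close> already inside
  \<open>W\<close>, where the induction hypothesis applies.\<close>

lemma ex_detects_kernel:
  assumes "invariant V"
  shows "\<exists>\<F>. detects_kernel \<F> V"
  using assms
proof (induction "dim V" arbitrary: V rule: less_induct)
  case less
  have V: "invariant V"
    by (rule less.prems)
  show ?case
  proof (cases "V = {0}")
    case True
    then have "detects_kernel {} V"
      by (simp add: detects_kernel_def)
    then show ?thesis ..
  next
    case False
    let ?P = "\<lambda>W. invariant W \<and> W \<subset> V"
    have "invariant {0}"
      using invariant_zero[OF V] invariant_subset[OF V] by (auto simp: invariant_def op_zero)
    then have "?P {0}"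
      using False invariant_zero[OF V] by auto
    moreover have dim: "dim W < dim V" if "?P W" for W
      using that V by (intro dim_strict_mono) (auto simp: invariant_def)
    ultimately obtain W where W: "?P W" and max: "\<And>U. ?P U \<Longrightarrow> dim U \<le> dim W"
      using ex_has_greatest_nat[of ?P "{0}" dim "dim V"] by (metis less_imp_le)
    have "U = W \<or> U = V" if U: "invariant U" "W \<subseteq> U" "U \<subseteq> V" for U
    proof (rule ccontr)
      assume "\<not> (U = W \<or> U = V)"
      then have "?P U" "W \<subset> U"
        using U by auto
      then have "dim W < dim U"
        using U W by (intro dim_strict_mono) (auto simp: invariant_def)
      then show False
        using max[OF \<open>?P U\<close>] by simp
    qed
    then have WV: "composition_factor W V"
      using W V by (simp add: composition_factor_def)
    obtain \<F> where F: "detects_kernel \<F> W"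
      using less.hyps[OF dim[OF W]] W by blast
    have "detects_kernel (insert (W, V) \<F>) V"
      unfolding detects_kernel_def
    proof (intro conjI ballI allI impI)
      show "finite (insert (W, V) \<F>)"
        using detects_kernel_finite[OF F] by simp
      show "composition_factor W' U" if "(W', U) \<in> insert (W, V) \<F>" for W' U
        using that WV detects_kernel_factor[OF F] by auto
      fix T v
      assume T: "T \<in> \<A>" "\<forall>W' U. (W', U) \<in> insert (W, V) \<F> \<longrightarrow> injective_mod T W' U"
        and v: "v \<in> V" "T v = 0"
      have "v \<in> W"
        using T(2) v W invariant_zero[of W] by (auto simp: injective_mod_def)
      then show "v = 0"
        using detects_kernel_zero[OF F T(1) _ _ v(2)] T(2) by blast
    qed
    then show ?thesis ..
  qed
qed

text \<open>Take a family of least cardinality. If injectivity on all other members implied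
  injectivity on V/W, then \<open>(W, V)\<close> could be removed.\<close>

lemma irredundant_detects_kernel:
  obtains \<F> where "detects_kernel \<F> E"
    "\<And>W V. (W, V) \<in> \<F> \<Longrightarrow> \<exists>T\<in>\<A>. \<not> injective_mod T W V \<and>
       (\<forall>W' V'. (W', V') \<in> \<F> - {(W, V)} \<longrightarrow> injective_mod T W' V')"
proof -
  let ?P = "\<lambda>\<F>. detects_kernel \<F> E"
  have "invariant E"
    by (simp add: invariant_def E_subspace E_invariant)
  then obtain \<F>0 where "?P \<F>0"
    using ex_detects_kernel by blast
  then obtain \<F> where F: "?P \<F>" and min: "\<And>\<G>. ?P \<G> \<Longrightarrow> card \<F> \<le> card \<G>"
    using ex_has_least_nat[of ?P \<F>0 card] by blast
  have "\<exists>T\<in>\<A>. \<not> injective_mod T W V \<and>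
       (\<forall>W' V'. (W', V') \<in> \<F> - {(W, V)} \<longrightarrow> injective_mod T W' V')" if WV: "(W, V) \<in> \<F>" for W V
  proof (rule ccontr)
    assume contra: "\<not> ?thesis"
    have "detects_kernel (\<F> - {(W, V)}) E"
      unfolding detects_kernel_def
    proof (intro conjI ballI allI impI)
      show "finite (\<F> - {(W, V)})"
        using detects_kernel_finite[OF F] by simp
      show "composition_factor W' U" if "(W', U) \<in> \<F> - {(W, V)}" for W' U
        using that detects_kernel_factor[OF F] by simp
      fix T v
      assume T: "T \<in> \<A>" "\<forall>W' U. (W', U) \<in> \<F> - {(W, V)} \<longrightarrow> injective_mod T W' U"
        and v: "v \<in> E" "T v = 0"
      have "injective_mod T W V"
        using contra T by blast
      then have "injective_mod T W' U" if "(W', U) \<in> \<F>" for W' U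
        using T(2) that by (cases "(W', U) = (W, V)") auto
      then show "v = 0"
        using detects_kernel_zero[OF F T(1) _ v] by blast
    qed
    then have "card \<F> \<le> card (\<F> - {(W, V)})"
      by (rule min)
    moreover have "card (\<F> - {(W, V)}) < card \<F>"
      using detects_kernel_finite[OF F] WV by (intro psubset_card_mono) auto
    ultimately show False
      by simp
  qed
  then show thesis
    using that F by blast
qed

section \<open>Diagonal matrix units and the block diagonal representation\<close>

text \<open>Write an annihilating polynomial of \<open>T\<close> on \<open>E\<close> as X^s q with
  q(0) nonzero; the operator is q(T). Where \<open>T\<close> is injective, T^s q(T) = 0 forces q(T)
  = 0. On a vector of V/W killed by \<open>T\<close>, however, q(T) acts as the nonzero scalar
  q(0).\<close>

lemma separating_operator:
  assumes T: "T \<in> \<A>" "\<not> injective_mod T W V" "invariant W" "invariant V"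
  obtains S where "S \<in> \<A>" "\<exists>v\<in>V. S v \<notin> W"
    "\<forall>W' V'. invariant W' \<longrightarrow> invariant V' \<longrightarrow> injective_mod T W' V' \<longrightarrow> (\<forall>v\<in>V'. S v \<in> W')"
proof -
  interpret T: linear_operator scale T
    by (rule linear_operator[OF T(1)])
  obtain p where p: "p \<noteq> 0" "\<And>v. v \<in> E \<Longrightarrow> ev T p v = 0"
    using T.poly_op_annihilates_subspace[OF finite_C E_subspace E_span E_invariant[OF T(1)]] by blast
  obtain s q where q: "p = [:0, 1:] ^ s * q" "\<not> [:0, 1:] dvd q"
    using order_decomp[OF p(1), of 0] by auto
  obtain a r where ar: "q = pCons a r"
    by (cases q)
  have a: "a \<noteq> 0"
    using q(2) poly_eq_0_iff_dvd[of q 0] by (simp add: ar)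
  have qA: "ev T q \<in> \<A>" and rA: "ev T r \<in> \<A>"
    by (rule poly_op_mem[OF T(1)])+
  have X: "ev T [:0, 1:] v = T v" for v
    by (simp add: T.T_zero)
  show thesis
  proof (rule that[OF qA])
    obtain v where v: "v \<in> V" "T v \<in> W" "v \<notin> W"
      using T(2) by (auto simp: injective_mod_def)
    have "q = [:a:] + r * [:0, 1:]"
      by (simp add: ar)
    then have eq: "ev T q v = scale a v + ev T r (T v)"
      by (simp only: T.poly_op_add T.poly_op_mult X) (simp add: T.T_zero)
    have "ev T q v \<notin> W"
    proof
      assume "ev T q v \<in> W"
      then have "scale (inverse a) (ev T q v - ev T r (T v)) \<in> W"
        by (intro invariant_scale invariant_diff invariant_op[OF _ rA] T(3) v(2))
      then show False
        using v(3) a by (simp add: eq)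
    qed
    then show "\<exists>v\<in>V. ev T q v \<notin> W"
      using v(1) by blast
  next
    show "\<forall>W' V'. invariant W' \<longrightarrow> invariant V' \<longrightarrow> injective_mod T W' V' \<longrightarrow> (\<forall>v\<in>V'. ev T q v \<in> W')"
    proof (intro allI impI ballI)
      fix W' V' v
      assume W': "invariant W'" and V': "invariant V'" and inj: "injective_mod T W' V'" and v: "v \<in> V'"
      have pow: "u \<in> W'" if "u \<in> V'" "ev T ([:0, 1:] ^ n) u \<in> W'" for n u
        using that
      proof (induction n arbitrary: u)
        case 0
        then show ?case
          by (simp add: T.T_zero one_pCons)
      next
        case (Suc n)
        have "ev T ([:0, 1:] ^ n) (T u) \<in> W'"
          using Suc.prems(2) by (simp only: power_Suc2 T.poly_op_mult X)
        then have "T u \<in> W'"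
          using Suc.IH invariant_op[OF V' T(1)] Suc.prems(1) by blast
        then show ?case
          using inj Suc.prems(1) by (auto simp: injective_mod_def)
      qed
      have "ev T ([:0, 1:] ^ s) (ev T q v) = 0"
        using p(2)[of v] v invariant_subset[OF V'] unfolding q(1) T.poly_op_mult by auto
      then show "ev T q v \<in> W'"
        using pow[OF invariant_op[OF V' qA v], of s] invariant_zero[OF W'] by simp
    qed
  qed
qed

text \<open>The operators vanishing on all members other than V/W form a two-sided ideal.
  Irredundancy and \<open>separating_operator\<close> show that it acts nontrivially on V/W, so
  density applies to this ideal rather than to all of \<A>.\<close>

lemma block_diagonal_units:
  obtains \<F> where "detects_kernel \<F> E"
    "\<And>W V B b. (W, V) \<in> \<F> \<Longrightarrow> finite B \<Longrightarrow> B \<subseteq> V \<Longrightarrow> b \<in> V \<Longrightarrow> b \<notin> span (B \<union> W) \<Longrightarrow>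
       \<exists>T\<in>\<A>. T b - b \<in> W \<and> (\<forall>x\<in>B. T x \<in> W) \<and>
         (\<forall>W' V'. (W', V') \<in> \<F> - {(W, V)} \<longrightarrow> (\<forall>v\<in>V'. T v \<in> W'))"
proof (rule irredundant_detects_kernel)
  fix \<F>
  assume F: "detects_kernel \<F> E"
    and irr: "\<And>W V. (W, V) \<in> \<F> \<Longrightarrow> \<exists>T\<in>\<A>. \<not> injective_mod T W V \<and>
       (\<forall>W' V'. (W', V') \<in> \<F> - {(W, V)} \<longrightarrow> injective_mod T W' V')"
  note cf = detects_kernel_factor[OF F]
  have inv: "invariant W" "invariant V" if "(W, V) \<in> \<F>" for W V
    using cf[OF that] by (auto simp: composition_factor_def)
  show thesis
  proof (rule that)
    fix W V B b
    assume WV: "(W, V) \<in> \<F>" and B: "finite B" "B \<subseteq> V" and b: "b \<in> V" "b \<notin> span (B \<union> W)"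
    define J where "J = {T \<in> \<A>. \<forall>W' V'. (W', V') \<in> \<F> - {(W, V)} \<longrightarrow> (\<forall>v\<in>V'. T v \<in> W')}"
    have J_op: "T v \<in> W'" if "T \<in> J" "(W', V') \<in> \<F> - {(W, V)}" "v \<in> V'" for T W' V' v
      using that unfolding J_def by blast
    have J: "two_sided_ideal J"
      unfolding two_sided_ideal_def
    proof (intro conjI ballI)
      show "J \<subseteq> \<A>"
        by (auto simp: J_def)
      have "(\<lambda>_. 0) \<in> \<A>"
        using scale[OF ident, of 0] by simp
      then show "(\<lambda>_. 0) \<in> J"
        using inv invariant_zero by (auto simp: J_def)
      show "(\<lambda>v. S v + T v) \<in> J" if S: "S \<in> J" and T: "T \<in> J" for S T
      proof -
        have "S v + T v \<in> W'" if "(W', V') \<in> \<F> - {(W, V)}" "v \<in> V'" for W' V' v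
          using invariant_add[OF inv(1)] J_op[OF S] J_op[OF T] that by blast
        then show ?thesis
          using S T add by (simp add: J_def)
      qed
      show "(\<lambda>v. S (T v)) \<in> J" if S: "S \<in> \<A>" and T: "T \<in> J" for S T
      proof -
        have "S (T v) \<in> W'" if "(W', V') \<in> \<F> - {(W, V)}" "v \<in> V'" for W' V' v
          using invariant_op[OF inv(1) S] J_op[OF T] that by blast
        then show ?thesis
          using S T comp by (simp add: J_def)
      qed
      show "(\<lambda>v. T (S v)) \<in> J" if S: "S \<in> \<A>" and T: "T \<in> J" for S T
      proof -
        have "T (S v) \<in> W'" if "(W', V') \<in> \<F> - {(W, V)}" "v \<in> V'" for W' V' v
          using invariant_op[OF inv(2) S] J_op[OF T] that by blast
        then show ?thesis
          using S T comp by (simp add: J_def)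
      qed
    qed
    obtain T where T: "T \<in> \<A>" "\<not> injective_mod T W V"
      "\<forall>W' V'. (W', V') \<in> \<F> - {(W, V)} \<longrightarrow> injective_mod T W' V'"
      using irr[OF WV] by blast
    obtain S where S: "S \<in> \<A>" "\<exists>v\<in>V. S v \<notin> W"
      "\<forall>W' V'. invariant W' \<longrightarrow> invariant V' \<longrightarrow> injective_mod T W' V' \<longrightarrow> (\<forall>v\<in>V'. S v \<in> W')"
      using separating_operator[OF T(1,2) inv[OF WV]] .
    have "S v \<in> W'" if "(W', V') \<in> \<F> - {(W, V)}" "v \<in> V'" for W' V' v
      using S(3) T(3) inv that by blast
    then have "S \<in> J"
      using S(1) by (simp add: J_def)
    then obtain D where "D \<in> J" "D b - b \<in> W" "\<And>x. x \<in> B \<Longrightarrow> D x \<in> W"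
      using dual_operator[OF J cf[OF WV] _ _ _ B b] S(2) by blast
    then show "\<exists>T\<in>\<A>. T b - b \<in> W \<and> (\<forall>x\<in>B. T x \<in> W) \<and>
         (\<forall>W' V'. (W', V') \<in> \<F> - {(W, V)} \<longrightarrow> (\<forall>v\<in>V'. T v \<in> W'))"
      unfolding J_def by blast
  qed (rule F)
qed

text \<open>\<open>M T\<close> is the matrix of \<open>T\<close> on the direct sum of the quotients
  V/W in an irredundant family. Dependence on \<open>E\<close> alone is recorded because
  \<open>right_mult_op\<close> is additive in the ring element only on \<open>ext_dual\<close>, not
  on arbitrary functions.\<close>

lemma block_matrix_representation:
  obtains J :: "(('v set \<times> 'v set) \<times> 'v) set"
    and M :: "('v \<Rightarrow> 'v) \<Rightarrow> ('v set \<times> 'v set) \<times> 'v \<Rightarrow> ('v set \<times> 'v set) \<times> 'v \<Rightarrow> 'k"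
  where "finite J"
    "\<And>S T. S \<in> \<A> \<Longrightarrow> T \<in> \<A> \<Longrightarrow> M (\<lambda>v. S v + T v) = M S + M T"
    "\<And>c T. T \<in> \<A> \<Longrightarrow> M (\<lambda>v. scale c (T v)) = mat_scale c (M T)"
    "\<And>S T. (\<And>v. v \<in> E \<Longrightarrow> S v = T v) \<Longrightarrow> M S = M T"
    "\<And>j. j \<in> J \<Longrightarrow> \<exists>T\<in>\<A>. \<forall>i\<in>J. \<forall>l\<in>J. M T i l = (if i = j \<and> l = j then 1 else 0)"
    "\<And>T v. T \<in> \<A> \<Longrightarrow> \<forall>y. (\<forall>i\<in>J. (\<Sum>l\<in>J. M T i l * y l) = 0) \<longrightarrow> (\<forall>l\<in>J. y l = 0) \<Longrightarrow>
      v \<in> E \<Longrightarrow> T v = 0 \<Longrightarrow> v = 0"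
proof (rule block_diagonal_units)
  fix \<F>
  assume F: "detects_kernel \<F> E"
    and units: "\<And>W V B b. (W, V) \<in> \<F> \<Longrightarrow> finite B \<Longrightarrow> B \<subseteq> V \<Longrightarrow> b \<in> V \<Longrightarrow> b \<notin> span (B \<union> W) \<Longrightarrow>
       \<exists>T\<in>\<A>. T b - b \<in> W \<and> (\<forall>x\<in>B. T x \<in> W) \<and>
         (\<forall>W' V'. (W', V') \<in> \<F> - {(W, V)} \<longrightarrow> (\<forall>v\<in>V'. T v \<in> W'))"
  note fin = detects_kernel_finite[OF F] and cf = detects_kernel_factor[OF F]
    and ker = detects_kernel_zero[OF F]
  have "\<exists>D C. D \<subseteq> C \<and> finite C \<and> independent C \<and> D \<subseteq> fst F \<and> C \<subseteq> snd F \<and>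
      fst F \<subseteq> span D \<and> snd F \<subseteq> span C" if F: "F \<in> \<F>" for F
  proof -
    have F': "invariant (fst F)" "invariant (snd F)" "fst F \<subseteq> snd F"
      using cf[of "fst F" "snd F"] F by (auto simp: composition_factor_def)
    obtain D where D: "D \<subseteq> fst F" "independent D" "fst F \<subseteq> span D"
      by (rule maximal_independent_subset)
    moreover have "D \<subseteq> snd F"
      using D(1) F'(3) by blast
    ultimately obtain B where B: "D \<subseteq> B" "B \<subseteq> snd F" "independent B" "snd F \<subseteq> span B"
      using maximal_independent_subset_extend by metis
    have "finite B"
      using independent_span_bound[OF finite_C B(3)] B(2) invariant_subset[OF F'(2)] E_span by blast
    then show ?thesis
      using B D by blast
  qed
  then obtain D C where DC: "\<And>F. F \<in> \<F> \<Longrightarrow> D F \<subseteq> C F \<and> finite (C F) \<and> independent (C F) \<and>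
      D F \<subseteq> fst F \<and> C F \<subseteq> snd F \<and> fst F \<subseteq> span (D F) \<and> snd F \<subseteq> span (C F)"
    by metis
  have inv: "invariant (fst F)" "invariant (snd F)" "fst F \<subseteq> snd F" if "F \<in> \<F>" for F
    using cf[of "fst F" "snd F"] that by (auto simp: composition_factor_def)
  define rep where "rep F = representation (C F)" for F
  \<comment> \<open>\<open>C F - D F\<close> induces a basis of the quotient; tagging its vectors
    with \<open>F\<close> keeps the blocks disjoint.\<close>
  define J where "J = Sigma \<F> (\<lambda>F. C F - D F)"
  \<comment> \<open>Column \<open>l\<close> holds the coordinates of the image of the basis vector
    \<open>snd l\<close>. Setting the entries outside \<open>J\<close> to zero makes the linearity
    of \<open>M\<close> an equation of functions.\<close>
  define M where "M T i l = (if i \<in> J \<and> l \<in> J \<and> fst i = fst l then rep (fst i) (T (snd l)) (snd i) else 0)"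
    for T :: "'v \<Rightarrow> 'v" and i l
  have finite_CF: "finite (C F)" and C_snd: "b \<in> C F \<Longrightarrow> b \<in> snd F" if "F \<in> \<F>" for F b
    using DC[OF that] by auto
  have J_snd: "snd l \<in> snd (fst l)" "fst l \<in> \<F>" if "l \<in> J" for l
  proof -
    have "fst l \<in> \<F> \<and> snd l \<in> C (fst l)"
      using that by (cases l) (simp add: J_def)
    then show "snd l \<in> snd (fst l)" "fst l \<in> \<F>"
      using C_snd by simp_all
  qed
  have J_op: "T (snd l) \<in> snd (fst l)" if "T \<in> \<A>" "l \<in> J" for T l
    using invariant_op[OF inv(2) that(1)] J_snd[OF that(2)] by simp
  have rep_add: "rep F (u + v) b = rep F u b + rep F v b"
    if "F \<in> \<F>" "u \<in> snd F" "v \<in> snd F" for F u v b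
    using DC[OF that(1)] that(2,3) by (auto simp: rep_def representation_add subset_iff)
  have rep_scale: "rep F (scale c v) b = c * rep F v b"
    if "F \<in> \<F>" "v \<in> snd F" for F v b c
    using DC[OF that(1)] that(2) by (auto simp: rep_def representation_scale subset_iff)
  \<comment> \<open>Coordinates outside \<open>D F\<close> therefore depend only on the class modulo
    \<open>fst F\<close>.\<close>
  have rep_W: "rep F w b = 0" if "F \<in> \<F>" "w \<in> fst F" "b \<notin> D F" for F w b
  proof -
    have "rep F w = representation (D F) w"
      unfolding rep_def using DC[OF that(1)] that(2) by (intro representation_extend) auto
    then show ?thesis
      using representation_ne_zero[of "D F" w b] that(3) by auto
  qed
  have rep_basis: "rep F b b' = (if b' = b then 1 else 0)" if "F \<in> \<F>" "b \<in> C F" for F b b'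
    using representation_basis[of "C F" b] DC[OF that(1)] that(2) by (simp add: rep_def)
  have rep_sum: "v = (\<Sum>b\<in>C F. scale (rep F v b) b)" if "F \<in> \<F>" "v \<in> snd F" for F v
    unfolding rep_def using DC[OF that(1)] that(2) by (intro sum_representation_eq[symmetric]) auto
  show thesis
  proof (rule that[of J M])
    show "finite J"
      unfolding J_def using fin finite_CF by (intro finite_SigmaI finite_Diff)
    show "M (\<lambda>v. S v + T v) = M S + M T" if "S \<in> \<A>" "T \<in> \<A>" for S T
    proof (intro ext)
      fix i l :: "('v set \<times> 'v set) \<times> 'v"
      have "rep (fst l) (S (snd l) + T (snd l)) (snd i) =
          rep (fst l) (S (snd l)) (snd i) + rep (fst l) (T (snd l)) (snd i)" if "l \<in> J"
        by (rule rep_add) (simp_all add: J_op J_snd that \<open>S \<in> \<A>\<close> \<open>T \<in> \<A>\<close>)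
      then show "M (\<lambda>v. S v + T v) i l = (M S + M T) i l"
        by (simp add: M_def)
    qed
    show "M (\<lambda>v. scale c (T v)) = mat_scale c (M T)" if "T \<in> \<A>" for c T
    proof (intro ext)
      fix i l :: "('v set \<times> 'v set) \<times> 'v"
      have "rep (fst l) (scale c (T (snd l))) (snd i) = c * rep (fst l) (T (snd l)) (snd i)" if "l \<in> J"
        by (rule rep_scale) (simp_all add: J_op J_snd that \<open>T \<in> \<A>\<close>)
      then show "M (\<lambda>v. scale c (T v)) i l = mat_scale c (M T) i l"
        by (simp add: M_def)
    qed
    show "M S = M T" if "\<And>v. v \<in> E \<Longrightarrow> S v = T v" for S T
    proof -
      have "snd l \<in> E" if "l \<in> J" for l
        using J_snd[OF that] invariant_subset[OF inv(2)] by blast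
      then show ?thesis
        using that by (auto simp: M_def fun_eq_iff)
    qed
    show "\<exists>T\<in>\<A>. \<forall>i\<in>J. \<forall>l\<in>J. M T i l = (if i = j \<and> l = j then 1 else 0)" if j: "j \<in> J" for j
    proof -
      obtain F b where Fb: "j = (F, b)" "F \<in> \<F>" "b \<in> C F" "b \<notin> D F"
        using j by (auto simp: J_def)
      note DCF = DC[OF Fb(2)]
      let ?B = "C F - D F - {b}"
      have "fst F \<subseteq> span (C F - {b})"
        using DCF Fb(4) span_mono[of "D F" "C F - {b}"] by blast
      then have "?B \<union> fst F \<subseteq> span (C F - {b})"
        using span_superset[of "C F - {b}"] by blast
      then have "span (?B \<union> fst F) \<subseteq> span (C F - {b})"
        by (rule span_minimal) simp
      moreover have "b \<notin> span (C F - {b})"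
        using DCF Fb(3) by (auto simp: dependent_def)
      ultimately have "b \<notin> span (?B \<union> fst F)"
        by blast
      then obtain T where T: "T \<in> \<A>" "T b - b \<in> fst F" "\<forall>x\<in>?B. T x \<in> fst F"
        "\<forall>W' V'. (W', V') \<in> \<F> - {F} \<longrightarrow> (\<forall>v\<in>V'. T v \<in> W')"
        using units[of "fst F" "snd F" ?B b] Fb DCF by auto
      have Tb: "rep F (T b) b' = (if b' = b then 1 else 0)" if "b' \<notin> D F" for b'
      proof -
        have "b \<in> snd F" "T b - b \<in> snd F"
          using Fb DCF T(2) inv(3)[OF Fb(2)] by auto
        then have "rep F (b + (T b - b)) b' = rep F b b' + rep F (T b - b) b'"
          by (rule rep_add[OF Fb(2)])
        then show ?thesis
          using rep_W[OF Fb(2) T(2) that] rep_basis[OF Fb(2,3)] by simp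
      qed
      have "M T i l = (if i = j \<and> l = j then 1 else 0)" if il: "i \<in> J" "l \<in> J" for i l
      proof -
        obtain F1 b1 F2 b2 where eq: "i = (F1, b1)" "l = (F2, b2)"
          by (metis surj_pair)
        have mem: "F1 \<in> \<F>" "b1 \<in> C F1" "b1 \<notin> D F1" "F2 \<in> \<F>" "b2 \<in> C F2" "b2 \<notin> D F2"
          using il by (auto simp: eq J_def)
        consider "F1 \<noteq> F2" | "F1 = F2" "F1 \<noteq> F" | "F1 = F" "F2 = F" "b2 = b" | "F1 = F" "F2 = F" "b2 \<noteq> b"
          by blast
        then show ?thesis
        proof cases
          case 1
          then show ?thesis
            by (auto simp: M_def eq Fb(1))
        next
          case 2
          have "b2 \<in> snd F2"
            using mem C_snd by blast
          then have "T b2 \<in> fst F1"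
            using T(4)[rule_format, of "fst F1" "snd F1" b2] mem 2 by simp
          then show ?thesis
            using 2 mem rep_W by (auto simp: M_def eq Fb(1))
        next
          case 3
          then show ?thesis
            using il mem Tb by (simp add: M_def eq Fb(1))
        next
          case 4
          then have "T b2 \<in> fst F"
            using T(3) mem by blast
          then show ?thesis
            using 4 mem rep_W by (simp add: M_def eq Fb(1))
        qed
      qed
      then show ?thesis
        using T(1) by blast
    qed
    fix T v
    assume T: "T \<in> \<A>" and v: "v \<in> E" "T v = 0"
      and nonsing: "\<forall>y. (\<forall>i\<in>J. (\<Sum>l\<in>J. M T i l * y l) = 0) \<longrightarrow> (\<forall>l\<in>J. y l = 0)"
    have "injective_mod T W V" if WV: "(W, V) \<in> \<F>" for W V
      unfolding injective_mod_def
    proof (intro ballI impI)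
      fix u assume u: "u \<in> V" "T u \<in> W"
      let ?F = "(W, V)"
      note DCF = DC[OF WV]
      \<comment> \<open>The coordinates of \<open>u\<close> in V/W, extended by zero to the other
        blocks. The matrix sends them to the coordinates of \<open>T u\<close>, which vanish modulo
        \<open>W\<close>; nonsingularity then puts \<open>u\<close> into \<open>W\<close>.\<close>
      define y where "y l = (if fst l = ?F then rep ?F u (snd l) else 0)" for l :: "('v set \<times> 'v set) \<times> 'v"
      have "(\<Sum>l\<in>J. M T i l * y l) = 0" if i: "i \<in> J" for i
      proof (cases "fst i = ?F")
        case False
        then show ?thesis
          by (intro sum.neutral) (auto simp: M_def y_def)
      next
        case True
        then obtain b where b: "i = (?F, b)" "b \<notin> D ?F"
          using i by (cases i) (auto simp: J_def)
        have C_V: "x \<in> C ?F \<Longrightarrow> x \<in> V" for x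
          using DCF by auto
        have rep_lin: "rep ?F (\<Sum>x\<in>Y. scale (c x) (T x)) b = (\<Sum>x\<in>Y. c x * rep ?F (T x) b)"
          if "finite Y" "Y \<subseteq> V" for Y c
          using that
        proof (induction Y rule: finite_induct)
          case empty
          then show ?case
            by (simp add: rep_def representation_zero)
        next
          case (insert x Y)
          have TV: "T z \<in> V" if "z \<in> insert x Y" for z
            using invariant_op[OF inv(2)[OF WV] T] insert.prems that by auto
          have "scale (c x) (T x) \<in> V" "(\<Sum>z\<in>Y. scale (c z) (T z)) \<in> V"
            using inv(2)[OF WV] TV by (auto intro!: subspace_sum subspace_scale invariant_subspace)
          then show ?case
            using insert TV rep_add[OF WV] rep_scale[OF WV] by simp
        qed
        have "(\<Sum>l\<in>J. M T i l * y l) = (\<Sum>l\<in>Pair ?F ` (C ?F - D ?F). M T i l * y l)"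
          using fin finite_CF WV by (intro sum.mono_neutral_right) (auto simp: J_def y_def intro!: finite_SigmaI)
        also have "\<dots> = (\<Sum>x\<in>C ?F - D ?F. rep ?F u x * rep ?F (T x) b)"
          using i WV by (subst sum.reindex) (auto simp: inj_on_def M_def y_def b J_def mult.commute intro!: sum.cong)
        also have "\<dots> = (\<Sum>x\<in>C ?F. rep ?F u x * rep ?F (T x) b)"
        proof (rule sum.mono_neutral_left)
          show "\<forall>x\<in>C ?F - (C ?F - D ?F). rep ?F u x * rep ?F (T x) b = 0"
          proof
            fix x assume "x \<in> C ?F - (C ?F - D ?F)"
            then have "x \<in> W"
              using DCF by auto
            then have "T x \<in> fst ?F"
              using invariant_op[OF inv(1)[OF WV] T] by simp
            then show "rep ?F u x * rep ?F (T x) b = 0"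
              using rep_W[OF WV _ b(2)] by simp
          qed
        qed (use DCF in auto)
        also have "\<dots> = rep ?F (T (\<Sum>x\<in>C ?F. scale (rep ?F u x) x)) b"
          using DCF C_V by (subst rep_lin[symmetric]) (auto simp: op_sum[OF T] op_scale[OF T])
        also have "\<dots> = rep ?F (T u) b"
          using rep_sum[OF WV, of u] u(1) by simp
        also have "\<dots> = 0"
          using rep_W[OF WV _ b(2)] u(2) by simp
        finally show ?thesis .
      qed
      then have y0: "\<forall>l\<in>J. y l = 0"
        using nonsing by blast
      have "rep ?F u x = 0" if "x \<in> C ?F - D ?F" for x
      proof -
        have "(?F, x) \<in> J"
          using that WV by (simp add: J_def)
        then show ?thesis
          using y0 by (force simp: y_def)
      qed
      then have "scale (rep ?F u x) x \<in> W" if "x \<in> C ?F" for x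
        using that DCF invariant_scale[OF inv(1)[OF WV]] invariant_zero[OF inv(1)[OF WV]]
        by (cases "x \<in> D ?F") auto
      then have "(\<Sum>x\<in>C ?F. scale (rep ?F u x) x) \<in> W"
        using inv(1)[OF WV] by (intro subspace_sum) (auto simp: invariant_subspace)
      then show "u \<in> W"
        using rep_sum[OF WV, of u] u(1) by simp
    qed
    then show "v = 0"
      using ker[OF T] v by blast
  qed
qed

end

section \<open>The scalar extension of the regular module\<close>

text \<open>The left action of the algebra on functions on it: composing the operators of
  \<open>x\<close> and \<open>y\<close> gives that of \<open>x * y\<close>, in this order.\<close>

definition right_mult_op :: "'a::times \<Rightarrow> ('a \<Rightarrow> 'k) \<Rightarrow> 'a \<Rightarrow> 'k" where
  "right_mult_op x g = (\<lambda>a. g (a * x))"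

abbreviation fun_scale :: "'k::field \<Rightarrow> ('a \<Rightarrow> 'k) \<Rightarrow> 'a \<Rightarrow> 'k" where
  "fun_scale \<equiv> \<lambda>c g a. c * g a"

abbreviation op_fun_scale :: "'k::field \<Rightarrow> (('a \<Rightarrow> 'k) \<Rightarrow> 'a \<Rightarrow> 'k) \<Rightarrow> ('a \<Rightarrow> 'k) \<Rightarrow> 'a \<Rightarrow> 'k" where
  "op_fun_scale \<equiv> \<lambda>c T g a. c * T g a"

lemma vector_space_fun_scale: "vector_space fun_scale"
  by (intro vector_space_fun) (unfold_locales, simp_all add: algebra_simps)

lemma vector_space_op_fun_scale: "vector_space op_fun_scale"
  using vector_space_fun[OF vector_space_fun_scale] .

locale finite_dimensional_algebra_over = algebra_over \<phi>
  for \<phi> :: "'f::field \<Rightarrow> 'a::{ring,monoid_mult}" +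
  fixes Basis :: "'a set"
  assumes finite_dimensional: "finite_dimensional_vector_space (algebra_scale \<phi>) Basis"
begin

sublocale A: finite_dimensional_vector_space "algebra_scale \<phi>" Basis
  by (rule finite_dimensional)

text \<open>The scalar extension of the dual of the regular module.\<close>

definition ext_dual :: "('a \<Rightarrow> 'f alg_closure) set" where
  "ext_dual = {g. (\<forall>x y. g (x + y) = g x + g y) \<and> (\<forall>c x. g (\<phi> c * x) = to_ac c * g x)}"

text \<open>Its restriction to \<open>ext_dual\<close> is the image of the scalar extension of the
  algebra to the closure; taking a span of operators avoids tensor products.\<close>

definition ext_algebra :: "(('a \<Rightarrow> 'f alg_closure) \<Rightarrow> 'a \<Rightarrow> 'f alg_closure) set" where
  "ext_algebra = module.span op_fun_scale (range right_mult_op)"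

definition ext_dual_basis :: "('a \<Rightarrow> 'f alg_closure) set" where
  "ext_dual_basis = (\<lambda>b a. to_ac (representation Basis a b)) ` Basis"

lemma ext_dual_sum:
  assumes "g \<in> ext_dual"
  shows "g (\<Sum>b\<in>B. \<phi> (c b) * b) = (\<Sum>b\<in>B. to_ac (c b) * g b)"
proof -
  have "g 0 = 0"
    using assms by (auto simp: ext_dual_def dest: spec[of _ 0])
  then show ?thesis
    using assms by (induction B rule: infinite_finite_induct) (auto simp: ext_dual_def)
qed

lemma right_mult_op_mem: "right_mult_op x \<in> ext_algebra"
proof -
  interpret Op: vector_space "op_fun_scale :: 'f alg_closure \<Rightarrow> (('a \<Rightarrow> _) \<Rightarrow> _) \<Rightarrow> _"
    by (rule vector_space_op_fun_scale)
  show ?thesis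
    by (simp add: ext_algebra_def Op.span_base)
qed

text \<open>The induction principle for \<open>ext_algebra\<close>: a linear condition on operators
  is checked on right multiplications.\<close>

lemma ext_algebra_subset:
  assumes "T \<in> ext_algebra" "module.subspace op_fun_scale P" "\<And>x. right_mult_op x \<in> P"
  shows "T \<in> P"
proof -
  interpret Op: vector_space "op_fun_scale :: 'f alg_closure \<Rightarrow> (('a \<Rightarrow> _) \<Rightarrow> _) \<Rightarrow> _"
    by (rule vector_space_op_fun_scale)
  show ?thesis
    using Op.span_minimal[of "range right_mult_op" P] assms by (auto simp: ext_algebra_def)
qed

sublocale ext: operator_algebra fun_scale ext_algebra ext_dual ext_dual_basis
proof -
  interpret V: vector_space "fun_scale :: 'f alg_closure \<Rightarrow> ('a \<Rightarrow> _) \<Rightarrow> _"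
    by (rule vector_space_fun_scale)
  interpret Op: vector_space "op_fun_scale :: 'f alg_closure \<Rightarrow> (('a \<Rightarrow> _) \<Rightarrow> _) \<Rightarrow> _"
    by (rule vector_space_op_fun_scale)
  have add: "T (g + h) = T g + T h" if "T \<in> ext_algebra" for T and g h :: "'a \<Rightarrow> 'f alg_closure"
  proof -
    have "T \<in> {T. T (g + h) = T g + T h}"
      using that
    proof (rule ext_algebra_subset)
      show "Op.subspace {T. T (g + h) = T g + T h}"
        by (rule Op.subspaceI) (simp_all add: fun_eq_iff distrib_left)
    qed (simp add: right_mult_op_def fun_eq_iff)
    then show ?thesis by simp
  qed
  have hom: "T (fun_scale c g) = fun_scale c (T g)" if "T \<in> ext_algebra" for T c and g :: "'a \<Rightarrow> 'f alg_closure"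
  proof -
    have "T \<in> {T. T (fun_scale c g) = fun_scale c (T g)}"
      using that
    proof (rule ext_algebra_subset)
      show "Op.subspace {T. T (fun_scale c g) = fun_scale c (T g)}"
        by (rule Op.subspaceI) (simp_all add: fun_eq_iff distrib_left mult.left_commute)
    qed (simp add: right_mult_op_def)
    then show ?thesis by simp
  qed
  have one: "right_mult_op 1 = (\<lambda>v :: 'a \<Rightarrow> 'f alg_closure. v)"
    by (simp add: right_mult_op_def fun_eq_iff)
  show "operator_algebra fun_scale ext_algebra ext_dual ext_dual_basis"
  proof (intro operator_algebra.intro operator_algebra_axioms.intro)
    show "Vector_Spaces.linear fun_scale fun_scale T" if "T \<in> ext_algebra" for T
      using add[OF that] hom[OF that] V.vector_space_axioms by (simp add: Vector_Spaces.linear_iff)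
    show "(\<lambda>v. v) \<in> ext_algebra"
      using right_mult_op_mem[of 1] by (simp add: one)
    show "(\<lambda>v. S (T v)) \<in> ext_algebra" if S: "S \<in> ext_algebra" and T: "T \<in> ext_algebra" for S T
    proof -
      \<comment> \<open>Closure under composition is extended linearly one factor at a time: first
        in \<open>T\<close>, with a right multiplication on the left, and then in
        \<open>S\<close>.\<close>
      have "T \<in> {T. (\<lambda>v. right_mult_op x (T v)) \<in> ext_algebra}" for x
        using T
      proof (rule ext_algebra_subset)
        have "(\<lambda>v. right_mult_op x ((P + Q) v)) =
            (\<lambda>v. right_mult_op x (P v)) + (\<lambda>v. right_mult_op x (Q v))"
          "(\<lambda>v. right_mult_op x (op_fun_scale c P v)) = op_fun_scale c (\<lambda>v. right_mult_op x (P v))"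
          "(\<lambda>v. right_mult_op x ((0 :: ('a \<Rightarrow> 'f alg_closure) \<Rightarrow> 'a \<Rightarrow> 'f alg_closure) v)) = 0"
          for P Q :: "('a \<Rightarrow> 'f alg_closure) \<Rightarrow> 'a \<Rightarrow> 'f alg_closure" and c
          by (auto simp: right_mult_op_def fun_eq_iff)
        then show "Op.subspace {T. (\<lambda>v. right_mult_op x (T v)) \<in> ext_algebra}"
          unfolding ext_algebra_def
          by (intro Op.subspaceI) (simp_all only: mem_Collect_eq Op.span_add Op.span_scale Op.span_zero)
        have "(\<lambda>v :: 'a \<Rightarrow> 'f alg_closure. right_mult_op x (right_mult_op y v)) = right_mult_op (x * y)" for y
          by (simp add: right_mult_op_def fun_eq_iff mult.assoc)
        then show "right_mult_op y \<in> {T. (\<lambda>v. right_mult_op x (T v)) \<in> ext_algebra}" for y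
          using right_mult_op_mem[of "x * y"] by simp
      qed
      moreover have "S \<in> {S. (\<lambda>v. S (T v)) \<in> ext_algebra}"
        if "\<And>x. (\<lambda>v. right_mult_op x (T v)) \<in> ext_algebra"
        using S
      proof (rule ext_algebra_subset)
        have "(\<lambda>v. (P + Q) (T v)) = (\<lambda>v. P (T v)) + (\<lambda>v. Q (T v))"
          "(\<lambda>v. op_fun_scale c P (T v)) = op_fun_scale c (\<lambda>v. P (T v))"
          "(\<lambda>v. (0 :: ('a \<Rightarrow> 'f alg_closure) \<Rightarrow> 'a \<Rightarrow> 'f alg_closure) (T v)) = 0"
          for P Q :: "('a \<Rightarrow> 'f alg_closure) \<Rightarrow> 'a \<Rightarrow> 'f alg_closure" and c
          by (auto simp: fun_eq_iff)
        then show "Op.subspace {S. (\<lambda>v. S (T v)) \<in> ext_algebra}"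
          unfolding ext_algebra_def
          by (intro Op.subspaceI) (simp_all only: mem_Collect_eq Op.span_add Op.span_scale Op.span_zero)
      qed (use that in simp)
      ultimately show ?thesis
        by simp
    qed
    show "(\<lambda>v. S v + T v) \<in> ext_algebra" if "S \<in> ext_algebra" "T \<in> ext_algebra" for S T
      using Op.span_add that by (fastforce simp: ext_algebra_def plus_fun_def)
    show "(\<lambda>v. fun_scale c (T v)) \<in> ext_algebra" if "T \<in> ext_algebra" for c T
      using Op.span_scale that by (simp add: ext_algebra_def)
    show "V.subspace ext_dual"
      by (rule V.subspaceI) (auto simp: ext_dual_def algebra_simps)
    show "T v \<in> ext_dual" if T: "T \<in> ext_algebra" and v: "v \<in> ext_dual" for T v
    proof -
      have "T \<in> {T. T v \<in> ext_dual}"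
        using T
      proof (rule ext_algebra_subset)
        show "Op.subspace {T. T v \<in> ext_dual}"
          by (rule Op.subspaceI) (auto simp: ext_dual_def algebra_simps)
      qed (use v in \<open>auto simp: ext_dual_def right_mult_op_def distrib_right mult.assoc\<close>)
      then show ?thesis by simp
    qed
    show "finite ext_dual_basis"
      by (simp add: ext_dual_basis_def A.finite_Basis)
    show "ext_dual \<subseteq> V.span ext_dual_basis"
    proof
      fix g assume g: "g \<in> ext_dual"
      \<comment> \<open>Expansion of \<open>g\<close> in the dual basis, with its values on
        \<open>Basis\<close> as coefficients.\<close>
      have "g a = (\<Sum>b\<in>Basis. fun_scale (g b) (\<lambda>a. to_ac (representation Basis a b))) a" for a
      proof -
        have "a = (\<Sum>b\<in>Basis. \<phi> (representation Basis a b) * b)"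
          using sum_representation_eq[of Basis a Basis] A.independent_Basis A.span_Basis A.finite_Basis
          by (simp add: algebra_scale_def)
        then have "g a = (\<Sum>b\<in>Basis. to_ac (representation Basis a b) * g b)"
          using ext_dual_sum[OF g] by metis
        also have "\<dots> = (\<Sum>b\<in>Basis. fun_scale (g b) (\<lambda>a. to_ac (representation Basis a b))) a"
          by (simp add: sum_fun_apply mult.commute)
        finally show ?thesis .
      qed
      then have "g = (\<Sum>b\<in>Basis. fun_scale (g b) (\<lambda>a. to_ac (representation Basis a b)))"
        by (rule ext)
      moreover have "\<dots> \<in> V.span ext_dual_basis"
        by (intro V.span_sum V.span_scale V.span_base) (auto simp: ext_dual_basis_def)
      ultimately show "g \<in> V.span ext_dual_basis"
        by simp
    qed
  qed (rule V.vector_space_axioms)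
qed

section \<open>From injective operators to units\<close>

text \<open>If 1 were not in the left ideal A x, a functional vanishing on A x but not at 1 would be
  a nonzero element of the kernel. So y x = 1 for some \<open>y\<close>; right multiplication by
  \<open>y\<close> is then injective, hence surjective by finite dimension, and \<open>y\<close> has
  a left inverse, which must be \<open>x\<close>.\<close>

lemma ring_unit_if_right_mult_op_injective:
  assumes inj: "\<And>g. g \<in> ext_dual \<Longrightarrow> right_mult_op x g = 0 \<Longrightarrow> g = 0"
  shows "ring_unit x"
proof -
  have sub: "subspace (range (\<lambda>a. a * x))"
  proof (rule subspaceI)
    show "0 \<in> range (\<lambda>a. a * x)"
      by (rule range_eqI[of _ _ 0]) simp
    show "u + v \<in> range (\<lambda>a. a * x)" if "u \<in> range (\<lambda>a. a * x)" "v \<in> range (\<lambda>a. a * x)" for u v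
      using that by (auto simp flip: distrib_right)
    show "algebra_scale \<phi> c u \<in> range (\<lambda>a. a * x)" if "u \<in> range (\<lambda>a. a * x)" for c u
      using that by (auto simp: algebra_scale_def simp flip: mult.assoc)
  qed
  have "1 \<in> range (\<lambda>a. a * x)"
  proof (rule ccontr)
    assume not: "1 \<notin> range (\<lambda>a. a * x)"
    obtain B where B: "B \<subseteq> range (\<lambda>a. a * x)" "independent B" "range (\<lambda>a. a * x) \<subseteq> span B"
      by (rule A.maximal_independent_subset)
    have spanB: "span B = range (\<lambda>a. a * x)"
      using B sub by (intro equalityI span_minimal)
    then have "independent (insert 1 B)"
      using not B(2) by (intro A.independent_insertI) auto
    then obtain D where D: "insert 1 B \<subseteq> D" "independent D" "UNIV \<subseteq> span D"
      using A.maximal_independent_subset_extend[of "insert 1 B" UNIV] by auto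
    \<comment> \<open>The coordinate at 1 in a basis that extends both 1 and a basis of the left
      ideal A x.\<close>
    define g where "g a = to_ac (representation D a 1)" for a
    have "v \<in> span D" for v
      using D(3) by blast
    then have "g \<in> ext_dual"
      using representation_add[OF D(2)] representation_scale[OF D(2)]
      by (simp add: ext_dual_def g_def algebra_scale_def)
    moreover have "right_mult_op x g = 0"
    proof
      fix a
      have "a * x \<in> span B"
        by (simp add: spanB)
      then have "representation D (a * x) = representation B (a * x)"
        using D by (intro representation_extend) auto
      moreover have "1 \<notin> B"
        using not B(1) by blast
      then have "representation B (a * x) 1 = 0"
        using representation_ne_zero by blast
      ultimately show "right_mult_op x g a = 0 a"
        by (simp add: right_mult_op_def g_def)
    qed
    ultimately have "g = 0"
      by (rule inj)
    moreover have "g 1 = 1"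
      using representation_basis[OF D(2), of 1] D(1) by (simp add: g_def)
    ultimately show False
      by simp
  qed
  then obtain y where y: "1 = y * x"
    by blast
  have "Vector_Spaces.linear (algebra_scale \<phi>) (algebra_scale \<phi>) (\<lambda>a. a * y)"
    using A.vector_space_axioms
    by (auto simp: Vector_Spaces.linear_iff algebra_scale_def distrib_right mult.assoc)
  moreover have "inj (\<lambda>a. a * y)"
  proof (rule injI)
    fix a b assume "a * y = b * y"
    then have "a * (y * x) = b * (y * x)"
      by (simp flip: mult.assoc)
    then show "a = b"
      by (simp flip: y)
  qed
  ultimately have "surj (\<lambda>a. a * y)"
    by (rule A.linear_inj_imp_surj)
  then obtain z where z: "1 = z * y"
    by (rule surjE)
  then have "z = x"
    using y by (metis mult.assoc mult_1_left mult_1_right)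
  then show ?thesis
    using y z by (auto simp: ring_unit_def)
qed

text \<open>The matrices of the elements of \<open>H\<close> are closed under addition, and their
  span over the closure contains the matrices of all of \<open>ext_algebra\<close>, in particular
  the diagonal units. Hence some \<open>h\<close> in \<open>H\<close> has a nonsingular matrix, so
  it acts injectively on \<open>ext_dual\<close> and is a unit.\<close>

theorem spanning_subgroup_contains_unit:
  assumes H: "add_subgroup H" and span: "span H = UNIV"
  shows "\<exists>u\<in>H. ring_unit u"
proof (rule ext.block_matrix_representation)
  fix J :: "((('a \<Rightarrow> 'f alg_closure) set \<times> ('a \<Rightarrow> 'f alg_closure) set) \<times> ('a \<Rightarrow> 'f alg_closure)) set"
    and M
  assume J: "finite J"
    and add: "\<And>S T. S \<in> ext_algebra \<Longrightarrow> T \<in> ext_algebra \<Longrightarrow> M (\<lambda>v. S v + T v) = M S + M T"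
    and scale: "\<And>c T. T \<in> ext_algebra \<Longrightarrow> M (\<lambda>v. fun_scale c (T v)) = mat_scale c (M T)"
    and cong: "\<And>S T. (\<And>v. v \<in> ext_dual \<Longrightarrow> S v = T v) \<Longrightarrow> M S = M T"
    and units: "\<And>j. j \<in> J \<Longrightarrow> \<exists>T\<in>ext_algebra. \<forall>i\<in>J. \<forall>l\<in>J. M T i l = (if i = j \<and> l = j then 1 else 0)"
    and nonsing: "\<And>T v. T \<in> ext_algebra \<Longrightarrow>
      \<forall>y. (\<forall>i\<in>J. (\<Sum>l\<in>J. M T i l * y l) = 0) \<longrightarrow> (\<forall>l\<in>J. y l = 0) \<Longrightarrow>
      v \<in> ext_dual \<Longrightarrow> T v = 0 \<Longrightarrow> v = 0"
  interpret Op: vector_space "op_fun_scale :: 'f alg_closure \<Rightarrow> (('a \<Rightarrow> _) \<Rightarrow> _) \<Rightarrow> _"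
    by (rule vector_space_op_fun_scale)
  interpret Mat: vector_space "mat_scale :: 'f alg_closure \<Rightarrow>
      ((('a \<Rightarrow> 'f alg_closure) set \<times> ('a \<Rightarrow> 'f alg_closure) set) \<times> ('a \<Rightarrow> 'f alg_closure) \<Rightarrow> _) \<Rightarrow> _"
    by (rule vector_space_mat_scale)
  let ?N = "\<lambda>x. M (right_mult_op x)"
  have N_add: "?N (x + y) = ?N x + ?N y" for x y
  proof -
    have "?N (x + y) = M (\<lambda>v. right_mult_op x v + right_mult_op y v)"
      by (rule cong) (auto simp: ext_dual_def right_mult_op_def distrib_left)
    then show ?thesis
      by (simp add: add right_mult_op_mem)
  qed
  have N_scale: "?N (\<phi> c * x) = mat_scale (to_ac c) (?N x)" for c x
  proof -
    have "?N (\<phi> c * x) = M (\<lambda>v. fun_scale (to_ac c) (right_mult_op x v))"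
    proof (rule cong)
      fix g assume g: "g \<in> ext_dual"
      have "a * (\<phi> c * x) = \<phi> c * (a * x)" for a
        using central by (metis mult.assoc)
      then show "right_mult_op (\<phi> c * x) g = fun_scale (to_ac c) (right_mult_op x g)"
        using g by (simp add: ext_dual_def right_mult_op_def)
    qed
    then show ?thesis
      by (simp add: scale right_mult_op_mem)
  qed
  have N_zero: "?N 0 = 0"
    using N_add[of 0 0] by simp
  let ?G = "?N ` H"
  \<comment> \<open>The span on the left is over the base field and the one on the right over its
    closure; \<open>to_ac\<close> turns base scalars into closure scalars.\<close>
  have "span H \<subseteq> {x. ?N x \<in> Mat.span ?G}"
  proof (rule span_minimal)
    show "H \<subseteq> {x. ?N x \<in> Mat.span ?G}"
      by (auto intro: Mat.span_base)
    show "subspace {x. ?N x \<in> Mat.span ?G}"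
      by (rule subspaceI)
        (simp_all add: N_zero N_add N_scale algebra_scale_def Mat.span_zero Mat.span_add Mat.span_scale)
  qed
  then have N_span: "?N x \<in> Mat.span ?G" for x
    using span by auto
  have M_span: "M T \<in> Mat.span ?G" if T: "T \<in> ext_algebra" for T
  proof -
    let ?P = "{T \<in> ext_algebra. M T \<in> Mat.span ?G}"
    have zero: "(0 :: ('a \<Rightarrow> 'f alg_closure) \<Rightarrow> _) = (\<lambda>v. fun_scale 0 (right_mult_op 1 v))"
      by (simp add: fun_eq_iff)
    have "M 0 = 0"
      unfolding zero by (subst scale[OF right_mult_op_mem]) (simp add: fun_eq_iff)
    have "Op.subspace ?P"
    proof (rule Op.subspaceI)
      show "0 \<in> ?P"
        using \<open>M 0 = 0\<close> by (simp add: ext_algebra_def Op.span_zero Mat.span_zero)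
    next
      fix S T assume ST: "S \<in> ?P" "T \<in> ?P"
      have "S + T = (\<lambda>v. S v + T v)"
        by (rule plus_fun_def)
      then have "M (S + T) = M S + M T"
        using ST by (simp only: add mem_Collect_eq)
      then show "S + T \<in> ?P"
        using ST Op.span_add Mat.span_add by (simp add: ext_algebra_def)
    next
      fix c T assume "T \<in> ?P"
      then show "op_fun_scale c T \<in> ?P"
        using Op.span_scale Mat.span_scale by (simp add: ext_algebra_def scale[unfolded ext_algebra_def])
    qed
    from this right_mult_op_mem N_span have "T \<in> ?P"
      by (intro ext_algebra_subset[OF T]) auto
    then show ?thesis by simp
  qed
  have "\<exists>Z\<in>?G. \<forall>y. (\<forall>i\<in>J. (\<Sum>l\<in>J. Z i l * y l) = 0) \<longrightarrow> (\<forall>l\<in>J. y l = 0)"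
  proof (rule exists_nonsingular_matrix[OF J])
    show "0 \<in> ?G"
      using H N_zero by (auto simp: add_subgroup_def intro!: image_eqI[of _ _ 0])
    show "Z + Y \<in> ?G" if "Z \<in> ?G" "Y \<in> ?G" for Z Y
      using that H by (auto simp: add_subgroup_def simp flip: N_add)
    show "\<exists>Z\<in>Mat.span ?G. \<forall>i\<in>J. \<forall>l\<in>J. Z i l = (if i = j \<and> l = j then 1 else 0)" if "j \<in> J" for j
      using units[OF that] M_span by blast
  qed
  then obtain h where h: "h \<in> H"
    "\<forall>y. (\<forall>i\<in>J. (\<Sum>l\<in>J. ?N h i l * y l) = 0) \<longrightarrow> (\<forall>l\<in>J. y l = 0)"
    by blast
  have "ring_unit h"
    using nonsing[OF right_mult_op_mem h(2)] by (rule ring_unit_if_right_mult_op_injective)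
  then show ?thesis
    using h(1) by blast
qed

end

theorem mainTheorem1:
  fixes \<phi> :: "'f::field \<Rightarrow> 'a::{ring,monoid_mult}"
    and H :: "'a set"
  assumes "finite_dimensional_algebra \<phi>"
    and "add_subgroup H"
    and "module.span (algebra_scale \<phi>) H = UNIV"
  shows "\<exists>u\<in>H. ring_unit u"
proof -
  obtain B where "algebra_over \<phi>" "finite_dimensional_vector_space (algebra_scale \<phi>) B"
    using assms(1) by (auto simp: finite_dimensional_algebra_def)
  then interpret finite_dimensional_algebra_over \<phi> B
    by (simp add: finite_dimensional_algebra_over_def finite_dimensional_algebra_over_axioms_def)
  show ?thesis
    using assms(2,3) by (rule spanning_subgroup_contains_unit)
qed

end
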